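(* Let $W:\Omega\times\Omega\to[0,1]$ be a properly subgraph-perfect graphon on an atomless Borel probability space $(\Omega,\nu)$. Then $W$ is inheritance-perfect, i.e., for every measurable $A\subset\Omega$ with $\nu(A)>0$ we have $\chi(W[A])=\omega(W[A])$.
   Context: A graphon is a symmetric measurable $W:\Omega\times\Omega\to[0,1]$. For a finite graph $H$ on $[k]$, $t(H,W)=\int\prod_{ij\in E(H)}W(x_i,x_j)\,d\nu^{\otimes k}$ and $t_{\mathrm{ind}}(H,W)=\int\prod_{ij\in E(H)}W(x_i,x_j)\prod_{ij\notin E(H),i<j}(1-W(x_i,x_j))\,d\nu^{\otimes k}$. A measurable set $B$ is independent in $W$ if $W=0$ a.e. on $B\times B$. A proper coloring with $k$ colors is a measurable $f:\Omega\to[k]$ with each $f^{-1}(i)$ independent; $\chi(W)$ is the least such $k$ ($\infty$ if none). The clique number is $\omega(W)=\max\{r:t(K_r,W)>0\}$. $W$ is subgraph-perfect if every finite graph $H$ with $t_{\mathrm{ind}}(H,W)>0$ satisfies $\chi(H)=\omega(H)$; it is properly subgraph-perfect if moreover $\chi(W)<\infty$. For $A\subset\Omega$ of positive measure, $W[A]$ is the restriction of $W$ to $A\times A$, viewed as a graphon on the probability space $A$ with measure $\nu_A(B)=\nu(B)/\nu(A)$. *)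

theory Defs
  imports "HOL-Probability.Probability"
begin

section \<open>Atomless standard Borel probability spaces\<close>

definition standard_borel :: "'a measure \<Rightarrow> bool" where
  "standard_borel M \<longleftrightarrow>
     (\<exists>X. completely_metrizable_space X \<and> second_countable X \<and> topspace X = space M \<and>
          sets M = sigma_sets (topspace X) {U. openin X U})"

definition atomless :: "'a measure \<Rightarrow> bool" where
  "atomless M \<longleftrightarrow>
     (\<forall>A\<in>sets M. 0 < emeasure M A \<longrightarrow>
        (\<exists>B\<in>sets M. B \<subseteq> A \<and> 0 < emeasure M B \<and> emeasure M B < emeasure M A))"


section \<open>Finite simple graphs\<close>

text \<open>A finite graph is given by its number of vertices \<^term>\<open>k :: nat\<close> and its set of edges, which
  are two-element subsets of the vertex set \<^term>\<open>{..<k :: nat}\<close>.\<close>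

definition complete_edges :: "nat \<Rightarrow> nat set set" where
  "complete_edges k = {e. e \<subseteq> {..<k} \<and> card e = 2}"

definition fin_graph :: "nat \<Rightarrow> nat set set \<Rightarrow> bool" where
  "fin_graph k E \<longleftrightarrow> E \<subseteq> complete_edges k"

definition graph_coloring :: "nat \<Rightarrow> nat set set \<Rightarrow> nat \<Rightarrow> (nat \<Rightarrow> nat) \<Rightarrow> bool" where
  "graph_coloring k E c f \<longleftrightarrow>
     f \<in> {..<k} \<rightarrow> {..<c} \<and> (\<forall>i<k. \<forall>j<k. {i, j} \<in> E \<longrightarrow> f i \<noteq> f j)"

definition graph_chromatic_number :: "nat \<Rightarrow> nat set set \<Rightarrow> nat" where
  "graph_chromatic_number k E = (LEAST c. \<exists>f. graph_coloring k E c f)"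

definition graph_clique :: "nat \<Rightarrow> nat set set \<Rightarrow> nat set \<Rightarrow> bool" where
  "graph_clique k E C \<longleftrightarrow> C \<subseteq> {..<k} \<and> (\<forall>i\<in>C. \<forall>j\<in>C. i \<noteq> j \<longrightarrow> {i, j} \<in> E)"

definition graph_clique_number :: "nat \<Rightarrow> nat set set \<Rightarrow> nat" where
  "graph_clique_number k E = Max {card C | C. graph_clique k E C}"


section \<open>Graphons\<close>

definition graphon :: "'a measure \<Rightarrow> ('a \<Rightarrow> 'a \<Rightarrow> real) \<Rightarrow> bool" where
  "graphon M W \<longleftrightarrow>
     (\<lambda>(x, y). W x y) \<in> borel_measurable (M \<Otimes>\<^sub>M M) \<and>
     (\<forall>x\<in>space M. \<forall>y\<in>space M. W x y = W y x) \<and>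
     (\<forall>x\<in>space M. \<forall>y\<in>space M. W x y \<in> {0..1})"

definition edge_pairs :: "nat \<Rightarrow> nat set set \<Rightarrow> (nat \<times> nat) set" where
  "edge_pairs k E = {(i, j). i < j \<and> j < k \<and> {i, j} \<in> E}"

definition nonedge_pairs :: "nat \<Rightarrow> nat set set \<Rightarrow> (nat \<times> nat) set" where
  "nonedge_pairs k E = {(i, j). i < j \<and> j < k \<and> {i, j} \<notin> E}"

definition hom_density :: "nat \<Rightarrow> nat set set \<Rightarrow> 'a measure \<Rightarrow> ('a \<Rightarrow> 'a \<Rightarrow> real) \<Rightarrow> real" where
  "hom_density k E M W =
     (\<integral>x. (\<Prod>(i, j)\<in>edge_pairs k E. W (x i) (x j)) \<partial>(\<Pi>\<^sub>M i\<in>{..<k}. M))"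

definition ind_density :: "nat \<Rightarrow> nat set set \<Rightarrow> 'a measure \<Rightarrow> ('a \<Rightarrow> 'a \<Rightarrow> real) \<Rightarrow> real" where
  "ind_density k E M W =
     (\<integral>x. (\<Prod>(i, j)\<in>edge_pairs k E. W (x i) (x j)) *
          (\<Prod>(i, j)\<in>nonedge_pairs k E. 1 - W (x i) (x j)) \<partial>(\<Pi>\<^sub>M i\<in>{..<k}. M))"

definition independent_in :: "'a measure \<Rightarrow> ('a \<Rightarrow> 'a \<Rightarrow> real) \<Rightarrow> 'a set \<Rightarrow> bool" where
  "independent_in M W B \<longleftrightarrow>
     B \<in> sets M \<and> (AE (x, y) in M \<Otimes>\<^sub>M M. (x, y) \<in> B \<times> B \<longrightarrow> W x y = 0)"

definition proper_coloring ::
  "'a measure \<Rightarrow> ('a \<Rightarrow> 'a \<Rightarrow> real) \<Rightarrow> nat \<Rightarrow> ('a \<Rightarrow> nat) \<Rightarrow> bool" where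
  "proper_coloring M W k f \<longleftrightarrow>
     f \<in> M \<rightarrow>\<^sub>M count_space {..<k} \<and> (\<forall>i<k. independent_in M W (f -` {i} \<inter> space M))"

text \<open>The infimum of the empty set is \<^term>\<open>\<infinity> :: enat\<close>; any other infimum is attained.\<close>

definition chromatic_number :: "'a measure \<Rightarrow> ('a \<Rightarrow> 'a \<Rightarrow> real) \<Rightarrow> enat" where
  "chromatic_number M W = Inf {enat k | k. \<exists>f. proper_coloring M W k f}"

text \<open>The supremum is the maximum if there are only finitely many such \<^term>\<open>r :: nat\<close>, and
  \<^term>\<open>\<infinity> :: enat\<close> otherwise.\<close>

definition clique_number :: "'a measure \<Rightarrow> ('a \<Rightarrow> 'a \<Rightarrow> real) \<Rightarrow> enat" where
  "clique_number M W = Sup {enat r | r. 0 < hom_density r (complete_edges r) M W}"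

definition subgraph_perfect :: "'a measure \<Rightarrow> ('a \<Rightarrow> 'a \<Rightarrow> real) \<Rightarrow> bool" where
  "subgraph_perfect M W \<longleftrightarrow>
     (\<forall>k E. fin_graph k E \<and> 0 < ind_density k E M W \<longrightarrow>
        graph_chromatic_number k E = graph_clique_number k E)"

definition properly_subgraph_perfect :: "'a measure \<Rightarrow> ('a \<Rightarrow> 'a \<Rightarrow> real) \<Rightarrow> bool" where
  "properly_subgraph_perfect M W \<longleftrightarrow> subgraph_perfect M W \<and> chromatic_number M W < \<infinity>"

text \<open>Since \<^term>\<open>W\<close> is a curried total function, the restriction of a graphon to \<^term>\<open>A \<times> A\<close>
  only changes the underlying probability space: it becomes \<^term>\<open>A\<close> with the normalized measure.\<close>

definition restrict_prob :: "'a measure \<Rightarrow> 'a set \<Rightarrow> 'a measure" where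
  "restrict_prob M A = restrict_space (uniform_measure M A) A"

lemma space_restrict_prob:
  assumes "A \<in> sets M"
  shows "space (restrict_prob M A) = A"
  using sets.sets_into_space[OF assms] by (auto simp: restrict_prob_def space_restrict_space)

lemma sets_restrict_prob:
  assumes "A \<in> sets M"
  shows "sets (restrict_prob M A) = {B \<in> sets M. B \<subseteq> A}"
  using assms by (auto simp: restrict_prob_def sets_restrict_space_iff sets_restrict_space)

lemma emeasure_restrict_prob:
  assumes "A \<in> sets M" "B \<in> sets M" "B \<subseteq> A"
  shows "emeasure (restrict_prob M A) B = emeasure M B / emeasure M A"
  using assms by (simp add: restrict_prob_def emeasure_restrict_space Int_absorb1)

definition inheritance_perfect :: "'a measure \<Rightarrow> ('a \<Rightarrow> 'a \<Rightarrow> real) \<Rightarrow> bool" where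
  "inheritance_perfect M W \<longleftrightarrow>
     (\<forall>A\<in>sets M. 0 < emeasure M A \<longrightarrow>
        chromatic_number (restrict_prob M A) W = clique_number (restrict_prob M A) W)"

end

theory Submission
  imports Defs
begin

text \<open>Let \<open>r\<close> be the clique number of \<open>W\<close>, assumed finite. Almost surely the graph \<open>{ij. W(x\<^sub>i, x\<^sub>j) > 0}\<close> on
  a finite random sample has positive induced density, so it is perfect with cliques of size at most
  \<open>r\<close> and is \<open>r\<close>-colorable. To color the whole space, approximate the support of \<open>W\<close> by a union of
  rectangles over a finite partition and sample many points from each cell; the color frequencies in
  the cells form a fractional coloring, that is, measures \<open>\<mu>\<^sub>1, \<dots>, \<mu>\<^sub>r\<close> with sum \<open>\<nu>\<close>, for which all
  \<open>\<mu>\<^sub>k \<otimes> \<mu>\<^sub>k\<close> give small mass to the support. By Tychonoff, a sequence of such fractional colorings has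
  a setwise limit along a filter, for which this mass is 0. The sets on which the densities of the
  limits are positive are then independent and cover the space.\<close>

section \<open>Finite product measures and sampling\<close>

text \<open>A restriction \<open>W[A]\<close> is again a graphon on a probability space, and events
  that are null for samples from \<open>M\<close> are null for samples from \<open>A\<close>. Hence
  subgraph-perfectness is inherited, and it suffices to compare the two numbers of \<open>W\<close>
  itself. That colors are at least as many as cliques demand is pigeonhole. The obstacle to the
  converse is that color classes of ever finer approximations need not converge to sets: their
  indicators may oscillate and have only weak limits, with values strictly between 0 and 1. Working
  with measures instead of sets makes the limit an object of the same kind. Two facts carry the
  bounds across it. On a union of rectangles over a finite partition, the mass of \<mu> \<otimes>
  \<mu> is a polynomial in the finitely many masses of cells, so setwise convergence is enough. And
  \<mu> \<le> \<nu> bounds the error of replacing the support by such a union, uniformly in the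
  coloring. Returning from measures to sets costs nothing, since independence is a matter of null
  sets: how small a positive density is does not matter.\<close>

lemma AE_PiM_reindex:
  assumes "\<And>i. i \<in> K \<Longrightarrow> prob_space (M i)" and "inj_on f I" "f \<in> I \<rightarrow> K"
    and "AE x in (\<Pi>\<^sub>M i\<in>I. M (f i)). P x"
  shows "AE x in Pi\<^sub>M K M. P (\<lambda>i\<in>I. x (f i))"
proof (rule AE_distrD[where f = "\<lambda>x. \<lambda>i\<in>I. x (f i)" and P = P])
  show "(\<lambda>x. \<lambda>i\<in>I. x (f i)) \<in> Pi\<^sub>M K M \<rightarrow>\<^sub>M (\<Pi>\<^sub>M i\<in>I. M (f i))"
    using assms(3) by (intro measurable_restrict measurable_component_singleton) auto
  show "AE x in distr (Pi\<^sub>M K M) (\<Pi>\<^sub>M i\<in>I. M (f i)) (\<lambda>x. \<lambda>i\<in>I. x (f i)). P x"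
    using assms(4) by (subst distr_PiM_reindex[OF assms(1-3)])
qed

text \<open>A binary product is a product over \<open>bool\<close>, so the pair is the marginal
  along the injection \<open>case_bool i j\<close>; injectivity is where \<open>i \<noteq> j\<close>
  enters.\<close>

lemma distr_PiM_pair:
  fixes M :: "'i \<Rightarrow> 'a measure"
  assumes "\<And>i. i \<in> I \<Longrightarrow> prob_space (M i)" and ij: "i \<in> I" "j \<in> I" "i \<noteq> j"
  shows "distr (Pi\<^sub>M I M) (M i \<Otimes>\<^sub>M M j) (\<lambda>x. (x i, x j)) = M i \<Otimes>\<^sub>M M j"
proof -
  let ?f = "case_bool i j"
  let ?R = "\<lambda>x. \<lambda>b\<in>UNIV. x (?f b)"
  have case_eq: "(\<lambda>b. M (?f b)) = case_bool (M i) (M j)"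
    by (auto split: bool.split)
  have f: "?f \<in> UNIV \<rightarrow> I" "inj_on ?f UNIV"
    using ij by (auto simp: inj_on_def split: bool.splits)
  have m: "?R \<in> Pi\<^sub>M I M \<rightarrow>\<^sub>M Pi\<^sub>M UNIV (case_bool (M i) (M j))"
    unfolding case_eq[symmetric] using f
    by (intro measurable_restrict measurable_component_singleton) auto
  have m2: "(\<lambda>x. (x True, x False)) \<in> Pi\<^sub>M UNIV (case_bool (M i) (M j)) \<rightarrow>\<^sub>M M i \<Otimes>\<^sub>M M j"
    using measurable_component_singleton[of True UNIV "case_bool (M i) (M j)"]
      measurable_component_singleton[of False UNIV "case_bool (M i) (M j)"]
    by (intro measurable_Pair) auto
  have "M i \<Otimes>\<^sub>M M j = distr (Pi\<^sub>M UNIV (case_bool (M i) (M j))) (M i \<Otimes>\<^sub>M M j) (\<lambda>x. (x True, x False))"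
    using assms by (intro pair_measure_eq_distr_PiM prob_space_imp_sigma_finite) auto
  also have "Pi\<^sub>M UNIV (case_bool (M i) (M j)) = distr (Pi\<^sub>M I M) (Pi\<^sub>M UNIV (case_bool (M i) (M j))) ?R"
    using distr_PiM_reindex[of I M ?f UNIV] assms f unfolding case_eq by simp
  also have "distr \<dots> (M i \<Otimes>\<^sub>M M j) (\<lambda>x. (x True, x False)) =
      distr (Pi\<^sub>M I M) (M i \<Otimes>\<^sub>M M j) (\<lambda>x. (x i, x j))"
    by (subst distr_distr[OF m2 m]) (simp add: comp_def)
  finally show ?thesis ..
qed

lemma AE_PiM_pair:
  fixes M :: "'i \<Rightarrow> 'a measure"
  assumes "\<And>i. i \<in> I \<Longrightarrow> prob_space (M i)" and ij: "i \<in> I" "j \<in> I" "i \<noteq> j"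
    and "AE z in M i \<Otimes>\<^sub>M M j. P z"
  shows "AE x in Pi\<^sub>M I M. P (x i, x j)"
proof (rule AE_distrD[where f = "\<lambda>x. (x i, x j)" and P = P])
  show "(\<lambda>x. (x i, x j)) \<in> Pi\<^sub>M I M \<rightarrow>\<^sub>M M i \<Otimes>\<^sub>M M j"
    using ij by simp
  show "AE z in distr (Pi\<^sub>M I M) (M i \<Otimes>\<^sub>M M j) (\<lambda>x. (x i, x j)). P z"
    using assms(5) by (subst distr_PiM_pair[OF assms(1-4)])
qed

text \<open>On boxes both sides are a product of quotients, and boxes determine the measure. The
  point is that a sample whose points are confined to prescribed cells is the unconditioned sample
  given an event of positive probability, so it inherits every almost sure property.\<close>

lemma PiM_uniform_measure:
  assumes "prob_space N" "finite I"
    and A: "\<And>i. i \<in> I \<Longrightarrow> A i \<in> sets N" "\<And>i. i \<in> I \<Longrightarrow> emeasure N (A i) \<noteq> 0"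
  shows "(\<Pi>\<^sub>M i\<in>I. uniform_measure N (A i)) = uniform_measure (\<Pi>\<^sub>M i\<in>I. N) (Pi\<^sub>E I A)"
proof -
  interpret N: prob_space N by fact
  interpret PN: product_prob_space "\<lambda>_. N" I by unfold_locales
  \<comment> \<open>Nothing is known about \<open>A\<close> outside \<open>I\<close>, but the
    product locale wants a probability measure at every index; \<open>N\<close> is the
    filler.\<close>
  define K where "K = (\<lambda>i. if i \<in> I then uniform_measure N (A i) else N)"
  have K: "prob_space (K i)" for i
    using A N.prob_space_axioms N.emeasure_finite unfolding K_def
    by (auto intro!: prob_space_uniform_measure)
  interpret K: product_prob_space K I
    using K by (intro product_prob_spaceI)
  have sets_K[simp]: "sets (K i) = sets N" for i
    by (simp add: K_def)
  have eq: "(\<Pi>\<^sub>M i\<in>I. uniform_measure N (A i)) = Pi\<^sub>M I K"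
    by (intro PiM_cong) (auto simp: K_def)
  have "uniform_measure (\<Pi>\<^sub>M i\<in>I. N) (Pi\<^sub>E I A) = Pi\<^sub>M I K"
  proof (rule K.PiM_eqI[OF \<open>finite I\<close>])
    show "sets (uniform_measure (\<Pi>\<^sub>M i\<in>I. N) (Pi\<^sub>E I A)) = sets (Pi\<^sub>M I K)"
      by (simp cong: sets_PiM_cong)
  next
    fix B assume B: "\<And>i. i \<in> I \<Longrightarrow> B i \<in> sets (K i)"
    have AB: "Pi\<^sub>E I A \<inter> Pi\<^sub>E I B = (\<Pi>\<^sub>E i\<in>I. A i \<inter> B i)"
      by auto
    have "emeasure (uniform_measure (\<Pi>\<^sub>M i\<in>I. N) (Pi\<^sub>E I A)) (Pi\<^sub>E I B) =
      (\<Prod>i\<in>I. emeasure N (A i \<inter> B i)) / (\<Prod>i\<in>I. emeasure N (A i))"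
      using A B \<open>finite I\<close>
      by (simp add: emeasure_uniform_measure sets_PiM_I_finite AB PN.emeasure_PiM)
    also have "\<dots> = (\<Prod>i\<in>I. emeasure N (A i \<inter> B i) / emeasure N (A i))"
      using A(2) N.emeasure_eq_measure
      by (simp add: prod_ennreal divide_ennreal prod_nonneg prod_pos measure_nonneg
          zero_less_measure_iff prod_dividef)
    also have "\<dots> = (\<Prod>i\<in>I. emeasure (K i) (B i))"
      using A B by (intro prod.cong) (auto simp: K_def)
    finally show "emeasure (uniform_measure (\<Pi>\<^sub>M i\<in>I. N) (Pi\<^sub>E I A)) (Pi\<^sub>E I B) =
      (\<Prod>i\<in>I. emeasure (K i) (B i))" .
  qed
  then show ?thesis by (simp add: eq)
qed

lemma AE_PiM_uniform_measure:
  assumes "prob_space N" "finite I"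
    and A: "\<And>i. i \<in> I \<Longrightarrow> A i \<in> sets N" "\<And>i. i \<in> I \<Longrightarrow> emeasure N (A i) \<noteq> 0"
    and "AE x in (\<Pi>\<^sub>M i\<in>I. N). P x"
  shows "AE x in (\<Pi>\<^sub>M i\<in>I. uniform_measure N (A i)). P x"
  using assms by (subst PiM_uniform_measure) (auto intro!: AE_uniform_measureI sets_PiM_I_finite)

lemma prob_space_restrict_prob:
  assumes "prob_space M" "A \<in> sets M" "emeasure M A \<noteq> 0"
  shows "prob_space (restrict_prob M A)"
proof -
  interpret prob_space M by fact
  show ?thesis using assms(2,3)
    by (intro prob_spaceI)
      (simp add: space_restrict_prob emeasure_restrict_prob ennreal_divide_self less_top[symmetric])
qed

lemma measurable_restrict_prob:
  "f \<in> M \<rightarrow>\<^sub>M N \<Longrightarrow> f \<in> restrict_prob M A \<rightarrow>\<^sub>M N"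
  unfolding restrict_prob_def by (intro measurable_restrict_space1) simp

text \<open>The space of \<open>restrict_prob M A\<close> is \<open>A\<close> itself, so only its
  image under the inclusion is the uniform measure on \<open>M\<close>. Null events are pulled back
  along the coordinatewise inclusion, after conditioning on a box has dealt with the uniform
  measure.\<close>

lemma AE_PiM_restrict_prob:
  assumes "prob_space M" "A \<in> sets M" "emeasure M A \<noteq> 0" "finite I"
    and "AE x in (\<Pi>\<^sub>M i\<in>I. M). P x"
  shows "AE x in (\<Pi>\<^sub>M i\<in>I. restrict_prob M A). P x"
proof -
  let ?N = "restrict_prob M A"
  interpret prob_space M by fact
  have U: "prob_space (uniform_measure M A)"
    using assms(3) by (intro prob_space_uniform_measure) auto
  have N: "prob_space ?N"
    using assms by (intro prob_space_restrict_prob)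
  have id: "(\<lambda>x. x) \<in> ?N \<rightarrow>\<^sub>M uniform_measure M A"
    by (intro measurable_restrict_prob) simp
  have distr: "distr ?N (uniform_measure M A) (\<lambda>x. x) = uniform_measure M A"
  proof (rule measure_eqI)
    fix B assume "B \<in> sets (distr ?N (uniform_measure M A) (\<lambda>x. x))"
    then show "emeasure (distr ?N (uniform_measure M A) (\<lambda>x. x)) B = emeasure (uniform_measure M A) B"
      using assms(2) id
      by (simp add: emeasure_distr space_restrict_prob emeasure_restrict_prob Int_commute)
  qed simp
  have "AE x in (\<Pi>\<^sub>M i\<in>I. uniform_measure M A). P x"
    using assms by (intro AE_PiM_uniform_measure) auto
  \<comment> \<open>\<open>compose I (\<lambda>x. x)\<close> is the identity on points of the
    product, since these are extensional.\<close>
  moreover have "distr (\<Pi>\<^sub>M i\<in>I. ?N) (\<Pi>\<^sub>M i\<in>I. uniform_measure M A) (compose I (\<lambda>x. x)) =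
      (\<Pi>\<^sub>M i\<in>I. uniform_measure M A)"
    using N U id distr by (subst distr_PiM_finite_prob_space'[OF \<open>finite I\<close>]) auto
  ultimately have AE: "AE x in distr (\<Pi>\<^sub>M i\<in>I. ?N) (\<Pi>\<^sub>M i\<in>I. uniform_measure M A) (compose I (\<lambda>x. x)). P x"
    by metis
  have "compose I (\<lambda>x. x) \<in> (\<Pi>\<^sub>M i\<in>I. ?N) \<rightarrow>\<^sub>M (\<Pi>\<^sub>M i\<in>I. uniform_measure M A)"
    unfolding compose_def
    by (intro measurable_restrict measurable_compose[OF _ id] measurable_component_singleton)
  then have "AE x in (\<Pi>\<^sub>M i\<in>I. ?N). P (compose I (\<lambda>x. x) x)"
    using AE by (rule AE_distrD)
  then show ?thesis
  proof (rule AE_mp, intro AE_I2 impI)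
    fix x assume "x \<in> space (\<Pi>\<^sub>M i\<in>I. ?N)" "P (compose I (\<lambda>x. x) x)"
    then show "P x"
      by (simp add: compose_def space_PiM PiE_def extensional_restrict[unfolded restrict_def] restrict_def)
  qed
qed

section \<open>Densities and colorings\<close>

lemma finite_edge_pairs: "finite (edge_pairs k E)"
  by (rule finite_subset[of _ "{..<k} \<times> {..<k}"]) (auto simp: edge_pairs_def)

lemma finite_nonedge_pairs: "finite (nonedge_pairs k E)"
  by (rule finite_subset[of _ "{..<k} \<times> {..<k}"]) (auto simp: nonedge_pairs_def)

locale graphon_space = prob_space M for M :: "'a measure" +
  fixes W :: "'a \<Rightarrow> 'a \<Rightarrow> real"
  assumes graphon: "graphon M W"
begin

lemma W_measurable [measurable]: "(\<lambda>z. W (fst z) (snd z)) \<in> borel_measurable (M \<Otimes>\<^sub>M M)"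
  using graphon by (simp add: graphon_def case_prod_beta')

lemma W_sym: "x \<in> space M \<Longrightarrow> y \<in> space M \<Longrightarrow> W x y = W y x"
  using graphon by (simp add: graphon_def)

lemma W_bounds: "x \<in> space M \<Longrightarrow> y \<in> space M \<Longrightarrow> 0 \<le> W x y"
  "x \<in> space M \<Longrightarrow> y \<in> space M \<Longrightarrow> W x y \<le> 1"
  using graphon by (simp_all add: graphon_def)

lemma W_PiM_measurable:
  assumes "i \<in> I" "j \<in> I"
  shows "(\<lambda>x. W (x i) (x j)) \<in> borel_measurable (\<Pi>\<^sub>M i\<in>I. M)"
  using measurable_compose[of "\<lambda>x. (x i, x j)", OF _ W_measurable] assms by simp

lemma prob_space_PiM_const: "prob_space (\<Pi>\<^sub>M i\<in>I. M)"
  using prob_space_axioms by (intro prob_space_PiM)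

text \<open>A nonnegative bounded integrand has integral 0 only if it vanishes almost surely, and a
  finite product vanishes only if a factor does. Below, a density matters only through whether it is
  0, and as a null event this survives conditioning and passing to subsamples.\<close>

lemma hom_density_eq_0_iff:
  "hom_density k E M W = 0 \<longleftrightarrow>
    (AE x in (\<Pi>\<^sub>M i\<in>{..<k}. M). \<exists>(i, j)\<in>edge_pairs k E. W (x i) (x j) = 0)"
proof -
  interpret P: prob_space "\<Pi>\<^sub>M i\<in>{..<k}. M" by (rule prob_space_PiM_const)
  let ?g = "\<lambda>x. \<Prod>(i, j)\<in>edge_pairs k E. W (x i) (x j)"
  have W01: "W (x i) (x j) \<in> {0..1}" if "x \<in> space (\<Pi>\<^sub>M i\<in>{..<k}. M)" "(i, j) \<in> edge_pairs k E" for x i j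
    using that W_bounds by (auto simp: edge_pairs_def space_PiM PiE_iff)
  have [measurable]: "?g \<in> borel_measurable (\<Pi>\<^sub>M i\<in>{..<k}. M)"
    by (auto simp: edge_pairs_def intro!: borel_measurable_prod W_PiM_measurable)
  have "?g x \<in> {0..1}" if "x \<in> space (\<Pi>\<^sub>M i\<in>{..<k}. M)" for x
    using W01[OF that] by (auto intro!: prod_nonneg prod_le_1)
  then have "hom_density k E M W = 0 \<longleftrightarrow> (AE x in (\<Pi>\<^sub>M i\<in>{..<k}. M). ?g x = 0)"
    unfolding hom_density_def
    by (intro integral_nonneg_eq_0_iff_AE P.integrable_const_bound[where B = 1]) auto
  then show ?thesis
    by (simp add: finite_edge_pairs prod_zero_iff case_prod_beta')
qed

lemma ind_density_eq_0_iff: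
  "ind_density k E M W = 0 \<longleftrightarrow>
    (AE x in (\<Pi>\<^sub>M i\<in>{..<k}. M). (\<exists>(i, j)\<in>edge_pairs k E. W (x i) (x j) = 0) \<or>
      (\<exists>(i, j)\<in>nonedge_pairs k E. W (x i) (x j) = 1))"
proof -
  interpret P: prob_space "\<Pi>\<^sub>M i\<in>{..<k}. M" by (rule prob_space_PiM_const)
  let ?g = "\<lambda>x. \<Prod>(i, j)\<in>edge_pairs k E. W (x i) (x j)"
  let ?h = "\<lambda>x. \<Prod>(i, j)\<in>nonedge_pairs k E. 1 - W (x i) (x j)"
  have W01: "W (x i) (x j) \<in> {0..1}" if "x \<in> space (\<Pi>\<^sub>M i\<in>{..<k}. M)" "i < j" "j < k" for x i j
    using that W_bounds by (auto simp: space_PiM PiE_iff)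
  have [measurable]: "?g \<in> borel_measurable (\<Pi>\<^sub>M i\<in>{..<k}. M)"
    by (auto simp: edge_pairs_def intro!: borel_measurable_prod W_PiM_measurable)
  have [measurable]: "?h \<in> borel_measurable (\<Pi>\<^sub>M i\<in>{..<k}. M)"
    by (auto simp: nonedge_pairs_def intro!: borel_measurable_prod borel_measurable_diff W_PiM_measurable)
  have "0 \<le> ?g x" "?g x \<le> 1" "0 \<le> ?h x" "?h x \<le> 1" if "x \<in> space (\<Pi>\<^sub>M i\<in>{..<k}. M)" for x
    using W01[OF that] by (auto simp: edge_pairs_def nonedge_pairs_def intro!: prod_nonneg prod_le_1)
  then have "ind_density k E M W = 0 \<longleftrightarrow> (AE x in (\<Pi>\<^sub>M i\<in>{..<k}. M). ?g x * ?h x = 0)"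
    unfolding ind_density_def
    by (intro integral_nonneg_eq_0_iff_AE P.integrable_const_bound[where B = 1])
      (auto simp: abs_mult intro!: mult_le_one)
  then show ?thesis
    by (simp add: finite_edge_pairs finite_nonedge_pairs prod_zero_iff case_prod_beta' eq_commute[of 1])
qed

lemma hom_density_nonneg: "0 \<le> hom_density k E M W"
  unfolding hom_density_def using W_bounds
  by (intro integral_nonneg_AE AE_I2 prod_nonneg) (auto simp: edge_pairs_def space_PiM PiE_iff)

lemma ind_density_nonneg: "0 \<le> ind_density k E M W"
  unfolding ind_density_def using W_bounds
  by (intro integral_nonneg_AE AE_I2 mult_nonneg_nonneg prod_nonneg)
    (auto simp: edge_pairs_def nonedge_pairs_def space_PiM PiE_iff)

end

section \<open>Restriction to a set of positive measure\<close>

lemma graphon_restrict_prob: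
  assumes "graphon M W" "A \<in> sets M"
  shows "graphon (restrict_prob M A) W"
  unfolding graphon_def
proof (intro conjI ballI)
  have id: "(\<lambda>x. x) \<in> restrict_prob M A \<rightarrow>\<^sub>M M"
    by (intro measurable_restrict_prob) simp
  have "(\<lambda>z. (fst z, snd z)) \<in> restrict_prob M A \<Otimes>\<^sub>M restrict_prob M A \<rightarrow>\<^sub>M M \<Otimes>\<^sub>M M"
    by (intro measurable_Pair measurable_compose[OF _ id]) simp_all
  then show "(\<lambda>(x, y). W x y) \<in> borel_measurable (restrict_prob M A \<Otimes>\<^sub>M restrict_prob M A)"
    using assms(1) by (auto simp: graphon_def intro: measurable_compose)
next
  fix x y assume "x \<in> space (restrict_prob M A)" "y \<in> space (restrict_prob M A)"
  then have "x \<in> space M" "y \<in> space M"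
    using sets.sets_into_space[OF assms(2)] by (auto simp: space_restrict_prob assms(2))
  then show "W x y = W y x" "W x y \<in> {0..1}"
    using assms(1) by (auto simp: graphon_def)
qed

text \<open>Restricting creates no new graph of positive induced density: an integrand that vanishes
  almost surely on samples from \<open>M\<close> does so on samples from \<open>A\<close>.\<close>

lemma subgraph_perfect_restrict_prob:
  assumes "prob_space M" "graphon M W" "A \<in> sets M" "emeasure M A \<noteq> 0" "subgraph_perfect M W"
  shows "subgraph_perfect (restrict_prob M A) W"
proof -
  interpret M: graphon_space M W
    using assms by (simp add: graphon_space_def graphon_space_axioms_def)
  interpret N: graphon_space "restrict_prob M A" W
    using assms by (simp add: graphon_space_def graphon_space_axioms_def prob_space_restrict_prob graphon_restrict_prob)
  have "0 < ind_density k E M W" if "0 < ind_density k E (restrict_prob M A) W" for k E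
  proof (rule ccontr)
    assume "\<not> 0 < ind_density k E M W"
    then have "ind_density k E M W = 0"
      using M.ind_density_nonneg[of k E] by simp
    then have "ind_density k E (restrict_prob M A) W = 0"
      unfolding M.ind_density_eq_0_iff N.ind_density_eq_0_iff
      using assms by (intro AE_PiM_restrict_prob) auto
    with that show False by simp
  qed
  then show ?thesis
    using assms(5) by (auto simp: subgraph_perfect_def)
qed

section \<open>Cliques and colors, in finite graphs, in the graphon and in random samples\<close>

lemma graph_coloring_chromatic_number:
  "\<exists>f. graph_coloring k E (graph_chromatic_number k E) f" if "fin_graph k E"
  unfolding graph_chromatic_number_def
proof (rule LeastI_ex)
  \<comment> \<open>Edges have two elements, so \<open>{i, i}\<close> is never an edge and
    \<open>id\<close> colors properly with \<open>k\<close> colors.\<close>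
  have "{i} \<notin> E" for i
    using that by (auto simp: fin_graph_def complete_edges_def)
  then show "\<exists>c f. graph_coloring k E c f"
    by (intro exI[of _ k] exI[of _ id]) (auto simp: graph_coloring_def)
qed

lemma graph_clique_number_attained:
  "\<exists>C. graph_clique k E C \<and> card C = graph_clique_number k E"
proof -
  let ?A = "{card C | C. graph_clique k E C}"
  have "finite ?A"
    by (rule finite_subset[of _ "card ` Pow {..<k}"]) (auto simp: graph_clique_def)
  moreover have "card {} \<in> ?A"
    by (intro CollectI exI[of _ "{}"]) (simp add: graph_clique_def)
  ultimately have "Max ?A \<in> ?A"
    by (intro Max_in) auto
  then show ?thesis
    unfolding graph_clique_number_def by force
qed

context graphon_space
begin

lemma AE_W_eq_0_if_same_color:
  assumes "proper_coloring M W k f"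
  shows "AE z in M \<Otimes>\<^sub>M M. f (fst z) = f (snd z) \<longrightarrow> W (fst z) (snd z) = 0"
proof -
  have f: "f x < k" if "x \<in> space M" for x
    using assms that by (auto simp: proper_coloring_def dest: measurable_space)
  have "AE z in M \<Otimes>\<^sub>M M. \<forall>i\<in>{..<k}.
      (fst z, snd z) \<in> (f -` {i} \<inter> space M) \<times> (f -` {i} \<inter> space M) \<longrightarrow> W (fst z) (snd z) = 0"
    using assms unfolding proper_coloring_def independent_in_def case_prod_beta'
    by (intro AE_finite_allI) blast+
  then show ?thesis
    by (rule AE_mp) (auto simp: space_pair_measure f intro!: AE_I2)
qed

text \<open>Pigeonhole: among \<open>r > k\<close> sample points two share a color, and almost
  surely \<open>W\<close> vanishes on every pair of one color, so the product over all pairs is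
  almost surely 0.\<close>

lemma clique_le_coloring:
  assumes "proper_coloring M W k f" "0 < hom_density r (complete_edges r) M W"
  shows "r \<le> k"
proof (rule ccontr)
  assume "\<not> r \<le> k"
  have "AE x in (\<Pi>\<^sub>M i\<in>{..<r}. M). f (x (fst p)) = f (x (snd p)) \<longrightarrow> W (x (fst p)) (x (snd p)) = 0"
    if "p \<in> edge_pairs r (complete_edges r)" for p
    using AE_PiM_pair[of "{..<r}" "\<lambda>_. M" "fst p" "snd p", OF _ _ _ _ AE_W_eq_0_if_same_color[OF assms(1)]]
      that prob_space_axioms by (auto simp: edge_pairs_def)
  then have "AE x in (\<Pi>\<^sub>M i\<in>{..<r}. M). \<forall>p\<in>edge_pairs r (complete_edges r).
      f (x (fst p)) = f (x (snd p)) \<longrightarrow> W (x (fst p)) (x (snd p)) = 0"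
    by (intro AE_finite_allI finite_edge_pairs)
  then have "AE x in (\<Pi>\<^sub>M i\<in>{..<r}. M).
      \<exists>(i, j)\<in>edge_pairs r (complete_edges r). W (x i) (x j) = 0"
  proof (rule AE_mp, intro AE_I2 impI)
    fix x assume x: "x \<in> space (\<Pi>\<^sub>M i\<in>{..<r}. M)"
      and W0: "\<forall>p\<in>edge_pairs r (complete_edges r).
        f (x (fst p)) = f (x (snd p)) \<longrightarrow> W (x (fst p)) (x (snd p)) = 0"
    have "(f \<circ> x) ` {..<r} \<subseteq> {..<k}"
      using x assms(1) by (auto simp: proper_coloring_def space_PiM PiE_iff dest!: measurable_space)
    then have "\<not> inj_on (f \<circ> x) {..<r}"
      using \<open>\<not> r \<le> k\<close> card_inj_on_le[of "f \<circ> x" "{..<r}" "{..<k}"] by auto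
    then obtain i j where "i < j" "j < r" "f (x i) = f (x j)"
      unfolding inj_on_def by (metis comp_apply lessThan_iff linorder_neqE_nat)
    then show "\<exists>(i, j)\<in>edge_pairs r (complete_edges r). W (x i) (x j) = 0"
      using W0 by (intro bexI[of _ "(i, j)"]) (auto simp: edge_pairs_def complete_edges_def)
  qed
  then show False
    using assms(2) hom_density_eq_0_iff[of r "complete_edges r", THEN iffD2] by linarith
qed

lemma clique_number_le_chromatic_number: "clique_number M W \<le> chromatic_number M W"
  unfolding clique_number_def chromatic_number_def
  by (intro Sup_least Inf_greatest) (auto dest: clique_le_coloring)

text \<open>Perfection turns the chromatic number of \<open>E\<close> into the size \<open>s\<close>
  of a largest clique \<open>C\<close>. Positive induced density forces positive density of the
  complete graph on \<open>s\<close> vertices, because the points sampled at the vertices of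
  \<open>C\<close> are again an independent sample; then \<open>bound\<close> applies.\<close>

lemma chromatic_number_le_if_ind_density:
  assumes "subgraph_perfect M W" and bound: "\<And>s. 0 < hom_density s (complete_edges s) M W \<Longrightarrow> s \<le> r"
    and "fin_graph m E" "0 < ind_density m E M W"
  shows "graph_chromatic_number m E \<le> r"
proof -
  obtain C where C: "graph_clique m E C" "card C = graph_clique_number m E"
    using graph_clique_number_attained by blast
  define s where "s = card C"
  have C_sub: "C \<subseteq> {..<m}"
    using C by (simp add: graph_clique_def)
  then obtain \<sigma> where \<sigma>: "bij_betw \<sigma> {..<s} C"
    using ex_bij_betw_nat_finite[of C] finite_subset unfolding s_def atLeast0LessThan by blast
  have "0 < hom_density s (complete_edges s) M W"
  proof (rule ccontr)
    assume "\<not> ?thesis"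
    then have "AE x in (\<Pi>\<^sub>M i\<in>{..<s}. M). \<exists>(i, j)\<in>edge_pairs s (complete_edges s). W (x i) (x j) = 0"
      using hom_density_nonneg[of s "complete_edges s"] hom_density_eq_0_iff by force
    then have "AE x in (\<Pi>\<^sub>M i\<in>{..<m}. M). \<exists>(i, j)\<in>edge_pairs s (complete_edges s).
        W ((\<lambda>i\<in>{..<s}. x (\<sigma> i)) i) ((\<lambda>i\<in>{..<s}. x (\<sigma> i)) j) = 0"
      using \<sigma> C_sub prob_space_axioms
      by (intro AE_PiM_reindex) (auto simp: bij_betw_def)
    then have "AE x in (\<Pi>\<^sub>M i\<in>{..<m}. M). \<exists>(i, j)\<in>edge_pairs m E. W (x i) (x j) = 0"
    proof (rule AE_mp, intro AE_I2 impI)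
      fix x assume x: "x \<in> space (\<Pi>\<^sub>M i\<in>{..<m}. M)"
        and "\<exists>(i, j)\<in>edge_pairs s (complete_edges s).
          W ((\<lambda>i\<in>{..<s}. x (\<sigma> i)) i) ((\<lambda>i\<in>{..<s}. x (\<sigma> i)) j) = 0"
      then obtain i j where ij: "i < j" "j < s" "W (x (\<sigma> i)) (x (\<sigma> j)) = 0"
        by (auto simp: edge_pairs_def)
      then have \<sigma>ij: "\<sigma> i \<in> C" "\<sigma> j \<in> C" "\<sigma> i \<noteq> \<sigma> j"
        using \<sigma> by (auto simp: bij_betw_def inj_on_def)
      then have "{\<sigma> i, \<sigma> j} \<in> E" "\<sigma> i < m" "\<sigma> j < m"
        using C C_sub by (auto simp: graph_clique_def)
      \<comment> \<open>\<open>\<sigma>\<close> need not be increasing, while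
        \<open>edge_pairs\<close> lists each edge once with its smaller end in front; hence both
        orders and the \<open>min\<close>/\<open>max\<close> witness.\<close>
      moreover have "W (x (\<sigma> j)) (x (\<sigma> i)) = 0"
        using ij x \<open>\<sigma> i < m\<close> \<open>\<sigma> j < m\<close> W_sym[of "x (\<sigma> i)" "x (\<sigma> j)"] by (auto simp: space_PiM PiE_iff)
      ultimately show "\<exists>(i, j)\<in>edge_pairs m E. W (x i) (x j) = 0"
        using \<sigma>ij ij
        by (intro bexI[of _ "(min (\<sigma> i) (\<sigma> j), max (\<sigma> i) (\<sigma> j))"])
          (auto simp: edge_pairs_def insert_commute min_def max_def)
    qed
    then have "ind_density m E M W = 0"
      unfolding ind_density_eq_0_iff by (rule AE_mp) simp
    then show False using assms(4) by simp
  qed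
  then have "s \<le> r" by (rule bound)
  then show ?thesis
    using assms C by (simp add: subgraph_perfect_def s_def)
qed

text \<open>There are finitely many graphs on \<open>m\<close> vertices, and each one that needs
  more than \<open>r\<close> colors has induced density 0, so almost surely none of these is
  compatible with the values of \<open>W\<close> on the sample. The graph of nonzero pairs always is
  compatible.\<close>

lemma AE_sample_colorable_lessThan:
  fixes m :: nat
  assumes "subgraph_perfect M W" and "\<And>s. 0 < hom_density s (complete_edges s) M W \<Longrightarrow> s \<le> r"
  shows "AE x in (\<Pi>\<^sub>M i\<in>{..<m}. M). \<exists>c\<in>{..<m} \<rightarrow> {..<r}.
    \<forall>i<m. \<forall>j<m. i \<noteq> j \<longrightarrow> W (x i) (x j) \<noteq> 0 \<longrightarrow> c i \<noteq> c j"
proof -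
  have "AE x in (\<Pi>\<^sub>M i\<in>{..<m}. M). \<forall>E\<in>Pow (complete_edges m).
      r < graph_chromatic_number m E \<longrightarrow>
      (\<exists>(i, j)\<in>edge_pairs m E. W (x i) (x j) = 0) \<or> (\<exists>(i, j)\<in>nonedge_pairs m E. W (x i) (x j) = 1)"
  proof (rule AE_finite_allI)
    show "finite (Pow (complete_edges m))"
      by (auto simp: complete_edges_def)
  next
    fix E assume E: "E \<in> Pow (complete_edges m)"
    show "AE x in (\<Pi>\<^sub>M i\<in>{..<m}. M). r < graph_chromatic_number m E \<longrightarrow>
      (\<exists>(i, j)\<in>edge_pairs m E. W (x i) (x j) = 0) \<or> (\<exists>(i, j)\<in>nonedge_pairs m E. W (x i) (x j) = 1)"
    proof (cases "r < graph_chromatic_number m E")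
      case True
      then have "\<not> 0 < ind_density m E M W"
        using chromatic_number_le_if_ind_density[OF assms, of m E] E by (auto simp: fin_graph_def)
      then have "ind_density m E M W = 0"
        using ind_density_nonneg[of m E] by simp
      then show ?thesis
        unfolding ind_density_eq_0_iff by (rule AE_mp) simp
    qed simp
  qed
  then show ?thesis
  proof (rule AE_mp, intro AE_I2 impI)
    fix x assume x: "x \<in> space (\<Pi>\<^sub>M i\<in>{..<m}. M)"
      and *: "\<forall>E\<in>Pow (complete_edges m). r < graph_chromatic_number m E \<longrightarrow>
      (\<exists>(i, j)\<in>edge_pairs m E. W (x i) (x j) = 0) \<or> (\<exists>(i, j)\<in>nonedge_pairs m E. W (x i) (x j) = 1)"
    \<comment> \<open>Pairs with \<open>W\<close> strictly between 0 and 1 count as edges. Thus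
      \<open>W\<close> is nonzero on edges and 0, in particular not 1, on nonedges, and both
      alternatives of the almost sure statement fail for \<open>E\<close>.\<close>
    define E where "E = {{i, j} | i j. i < m \<and> j < m \<and> i \<noteq> j \<and> W (x i) (x j) \<noteq> 0}"
    have E: "E \<subseteq> complete_edges m"
      by (auto simp: E_def complete_edges_def)
    have sym: "W (x i) (x j) = W (x j) (x i)" if "i < m" "j < m" for i j
      using x that by (intro W_sym) (auto simp: space_PiM PiE_iff)
    have iff: "{i, j} \<in> E \<longleftrightarrow> W (x i) (x j) \<noteq> 0" if "i < m" "j < m" "i \<noteq> j" for i j
      using that sym[of i j] by (auto simp: E_def doubleton_eq_iff)
    then have "\<not> r < graph_chromatic_number m E"
      using * E by (force simp: edge_pairs_def nonedge_pairs_def)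
    moreover obtain c where "graph_coloring m E (graph_chromatic_number m E) c"
      using graph_coloring_chromatic_number[of m E] E by (auto simp: fin_graph_def)
    ultimately have "c \<in> {..<m} \<rightarrow> {..<r}"
        "\<forall>i<m. \<forall>j<m. i \<noteq> j \<longrightarrow> W (x i) (x j) \<noteq> 0 \<longrightarrow> c i \<noteq> c j"
      using iff unfolding graph_coloring_def by (auto simp: Pi_iff) (metis lessThan_iff order_less_le_trans not_less)
    then show "\<exists>c\<in>{..<m} \<rightarrow> {..<r}.
        \<forall>i<m. \<forall>j<m. i \<noteq> j \<longrightarrow> W (x i) (x j) \<noteq> 0 \<longrightarrow> c i \<noteq> c j"
      by blast
  qed
qed

text \<open>Stratified samples are indexed by pairs of a cell and a position, hence the transfer to
  an arbitrary finite index set.\<close>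

lemma AE_sample_colorable:
  assumes "subgraph_perfect M W" and "\<And>s. 0 < hom_density s (complete_edges s) M W \<Longrightarrow> s \<le> r"
    and "finite I"
  shows "AE x in (\<Pi>\<^sub>M i\<in>I. M). \<exists>c\<in>I \<rightarrow> {..<r}.
    \<forall>i\<in>I. \<forall>j\<in>I. i \<noteq> j \<longrightarrow> W (x i) (x j) \<noteq> 0 \<longrightarrow> c i \<noteq> c j"
proof -
  obtain \<sigma> where \<sigma>: "bij_betw \<sigma> {..<card I} I"
    using ex_bij_betw_nat_finite[OF assms(3)] unfolding atLeast0LessThan by blast
  let ?\<tau> = "the_inv_into {..<card I} \<sigma>"
  have "AE x in (\<Pi>\<^sub>M i\<in>I. M). \<exists>c\<in>{..<card I} \<rightarrow> {..<r}. \<forall>i<card I. \<forall>j<card I. i \<noteq> j \<longrightarrow>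
      W ((\<lambda>i\<in>{..<card I}. x (\<sigma> i)) i) ((\<lambda>i\<in>{..<card I}. x (\<sigma> i)) j) \<noteq> 0 \<longrightarrow> c i \<noteq> c j"
    using \<sigma> prob_space_axioms assms(1,2)
    by (intro AE_PiM_reindex AE_sample_colorable_lessThan) (auto simp: bij_betw_def)
  then show ?thesis
  proof (rule AE_mp, intro AE_I2 impI)
    fix x assume "\<exists>c\<in>{..<card I} \<rightarrow> {..<r}. \<forall>i<card I. \<forall>j<card I. i \<noteq> j \<longrightarrow>
      W ((\<lambda>i\<in>{..<card I}. x (\<sigma> i)) i) ((\<lambda>i\<in>{..<card I}. x (\<sigma> i)) j) \<noteq> 0 \<longrightarrow> c i \<noteq> c j"
    then obtain c where c: "c \<in> {..<card I} \<rightarrow> {..<r}"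
      "\<And>i j. i < card I \<Longrightarrow> j < card I \<Longrightarrow> i \<noteq> j \<Longrightarrow> W (x (\<sigma> i)) (x (\<sigma> j)) \<noteq> 0 \<Longrightarrow> c i \<noteq> c j"
      by auto
    have \<tau>: "?\<tau> i < card I" "\<sigma> (?\<tau> i) = i" if "i \<in> I" for i
      using \<sigma> that the_inv_into_into[of \<sigma> "{..<card I}" i "{..<card I}"]
      by (auto simp: bij_betw_def f_the_inv_into_f)
    show "\<exists>c\<in>I \<rightarrow> {..<r}. \<forall>i\<in>I. \<forall>j\<in>I. i \<noteq> j \<longrightarrow> W (x i) (x j) \<noteq> 0 \<longrightarrow> c i \<noteq> c j"
    proof (intro bexI[of _ "c \<circ> ?\<tau>"] ballI impI)
      fix i j assume "i \<in> I" "j \<in> I" "i \<noteq> j" "W (x i) (x j) \<noteq> 0"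
      then show "(c \<circ> ?\<tau>) i \<noteq> (c \<circ> ?\<tau>) j"
        using c(2)[of "?\<tau> i" "?\<tau> j"] \<tau>[of i] \<tau>[of j] by force
    qed (use c(1) \<tau> in auto)
  qed
qed

end

section \<open>Approximation by unions of rectangles\<close>

text \<open>A partition is encoded by a labelling \<open>p\<close> whose fibers are the cells, so
  that a common refinement is a pairing of labels. \<open>R\<close> is an arbitrary set of label
  pairs, possibly infinite or with labels that do not occur; this lets a complement be taken as
  \<open>- R\<close>.\<close>

definition cell_union :: "'a set \<Rightarrow> ('a \<Rightarrow> nat) \<Rightarrow> (nat \<times> nat) set \<Rightarrow> ('a \<times> 'a) set" where
  "cell_union X p R = {z \<in> X \<times> X. (p (fst z), p (snd z)) \<in> R}"

definition finite_partition_map :: "'a measure \<Rightarrow> ('a \<Rightarrow> nat) \<Rightarrow> bool" where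
  "finite_partition_map M p \<longleftrightarrow> p \<in> M \<rightarrow>\<^sub>M count_space UNIV \<and> finite (p ` space M)"

lemma sets_cell_union [measurable]:
  assumes "finite_partition_map M p"
  shows "cell_union (space M) p R \<in> sets (M \<Otimes>\<^sub>M M)"
proof -
  have [measurable]: "p \<in> M \<rightarrow>\<^sub>M count_space UNIV"
    using assms by (simp add: finite_partition_map_def)
  have "(\<lambda>z. (p (fst z), p (snd z))) \<in> M \<Otimes>\<^sub>M M \<rightarrow>\<^sub>M count_space UNIV \<Otimes>\<^sub>M count_space UNIV"
    by measurable
  then have "(\<lambda>z. (p (fst z), p (snd z))) \<in> M \<Otimes>\<^sub>M M \<rightarrow>\<^sub>M count_space UNIV"
    by (simp add: pair_measure_countable)
  then have "(\<lambda>z. (p (fst z), p (snd z))) -` R \<inter> space (M \<Otimes>\<^sub>M M) \<in> sets (M \<Otimes>\<^sub>M M)"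
    by (rule measurable_sets) simp
  also have "(\<lambda>z. (p (fst z), p (snd z))) -` R \<inter> space (M \<Otimes>\<^sub>M M) = cell_union (space M) p R"
    by (auto simp: cell_union_def space_pair_measure)
  finally show ?thesis .
qed

lemma sets_cell:
  assumes "finite_partition_map M p"
  shows "p -` A \<inter> space M \<in> sets M"
  using assms by (auto simp: finite_partition_map_def intro: measurable_sets)

lemma finite_partition_map_indicator:
  assumes "A \<in> sets M"
  shows "finite_partition_map M (\<lambda>x. if x \<in> A then 1 else 0)"
proof -
  have "finite ((\<lambda>x. if x \<in> A then 1 else 0 :: nat) ` space M)"
    by (rule finite_subset[of _ "{0, 1}"]) auto
  then show ?thesis
    using assms by (simp add: finite_partition_map_def)
qed

lemma finite_partition_map_prod_encode:
  assumes "finite_partition_map M p" "finite_partition_map M q"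
  shows "finite_partition_map M (\<lambda>x. prod_encode (p x, q x))"
proof -
  have [measurable]: "p \<in> M \<rightarrow>\<^sub>M count_space UNIV" "q \<in> M \<rightarrow>\<^sub>M count_space UNIV"
    using assms by (auto simp: finite_partition_map_def)
  have "(\<lambda>x. (p x, q x)) \<in> M \<rightarrow>\<^sub>M count_space UNIV"
    using measurable_Pair[of p M "count_space UNIV" q "count_space UNIV"]
    by (simp add: pair_measure_countable)
  then have "(\<lambda>x. prod_encode (p x, q x)) \<in> M \<rightarrow>\<^sub>M count_space UNIV"
    by (rule measurable_compose) simp
  moreover have "finite ((\<lambda>x. prod_encode (p x, q x)) ` space M)"
    by (rule finite_subset[of _ "prod_encode ` (p ` space M \<times> q ` space M)"])
      (use assms in \<open>auto simp: finite_partition_map_def\<close>)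
  ultimately show ?thesis
    by (simp add: finite_partition_map_def)
qed

context prob_space
begin

interpretation pair: pair_prob_space M M ..

definition cell_approximable :: "('a \<times> 'a) set \<Rightarrow> bool" where
  "cell_approximable S \<longleftrightarrow> (\<forall>e>0. \<exists>p R. finite_partition_map M p \<and>
     measure (M \<Otimes>\<^sub>M M) (sym_diff S (cell_union (space M) p R)) < e)"

text \<open>Both unions are rewritten over the common refinement, from whose labels
  \<open>prod_decode\<close> recovers the old ones. The symmetric difference of two unions lies in
  the union of the symmetric differences, so two errors below \<open>e / 2\<close> suffice.\<close>

lemma cell_approximable_Un:
  assumes "cell_approximable S" "cell_approximable S'" "S \<in> sets (M \<Otimes>\<^sub>M M)" "S' \<in> sets (M \<Otimes>\<^sub>M M)"
  shows "cell_approximable (S \<union> S')"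
  unfolding cell_approximable_def
proof (intro allI impI)
  fix e :: real assume "e > 0"
  then obtain p R p' R'
    where pR: "finite_partition_map M p"
      "measure (M \<Otimes>\<^sub>M M) (sym_diff S (cell_union (space M) p R)) < e / 2"
    and pR': "finite_partition_map M p'"
      "measure (M \<Otimes>\<^sub>M M) (sym_diff S' (cell_union (space M) p' R')) < e / 2"
    using assms(1,2) unfolding cell_approximable_def by (meson half_gt_zero)
  define P where "P x = prod_encode (p x, p' x)" for x
  define Q where "Q = {(i, j). (fst (prod_decode i), fst (prod_decode j)) \<in> R \<or>
    (snd (prod_decode i), snd (prod_decode j)) \<in> R'}"
  have P: "finite_partition_map M P"
    unfolding P_def using pR(1) pR'(1) by (rule finite_partition_map_prod_encode)
  have "cell_union (space M) P Q = cell_union (space M) p R \<union> cell_union (space M) p' R'"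
    by (auto simp: cell_union_def P_def Q_def)
  then have "measure (M \<Otimes>\<^sub>M M) (sym_diff (S \<union> S') (cell_union (space M) P Q)) \<le>
    measure (M \<Otimes>\<^sub>M M) (sym_diff S (cell_union (space M) p R) \<union> sym_diff S' (cell_union (space M) p' R'))"
    using assms sets_cell_union[OF pR(1)] sets_cell_union[OF pR'(1)]
    by (intro pair.P.finite_measure_mono) auto
  also have "\<dots> \<le> measure (M \<Otimes>\<^sub>M M) (sym_diff S (cell_union (space M) p R)) +
      measure (M \<Otimes>\<^sub>M M) (sym_diff S' (cell_union (space M) p' R'))"
    using assms sets_cell_union[OF pR(1)] sets_cell_union[OF pR'(1)]
    by (intro measure_Un_le) auto
  also have "\<dots> < e"
    using pR(2) pR'(2) by simp
  finally show "\<exists>p R. finite_partition_map M p \<and>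
      measure (M \<Otimes>\<^sub>M M) (sym_diff (S \<union> S') (cell_union (space M) p R)) < e"
    using P by blast
qed

lemma cell_approximable_empty: "cell_approximable {}"
proof -
  have "cell_union (space M) (\<lambda>_. 0) {} = {}"
    by (auto simp: cell_union_def)
  moreover have "finite_partition_map M (\<lambda>_. 0)"
    by (simp add: finite_partition_map_def image_constant_conv)
  ultimately show ?thesis
    unfolding cell_approximable_def by (intro allI impI exI[of _ "\<lambda>_. 0"] exI[of _ "{}"]) simp
qed

lemma cell_approximable_UN_lessThan:
  fixes A :: "nat \<Rightarrow> ('a \<times> 'a) set"
  assumes "\<And>i. cell_approximable (A i)" "\<And>i. A i \<in> sets (M \<Otimes>\<^sub>M M)"
  shows "cell_approximable (\<Union>i<k. A i)"
proof (induction k)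
  case (Suc k)
  have "(\<Union>i<Suc k. A i) = A k \<union> (\<Union>i<k. A i)"
    by (auto simp: less_Suc_eq)
  moreover have "(\<Union>i<k. A i) \<in> sets (M \<Otimes>\<^sub>M M)"
    using assms(2) by blast
  ultimately show ?case
    using cell_approximable_Un[OF assms(1) Suc assms(2)] by metis
qed (simp add: cell_approximable_empty)

text \<open>Rectangles are themselves unions of cells, and approximability passes to complements and
  countable unions, so the induction that generates the product sigma-algebra applies.\<close>

theorem cell_approximable:
  assumes "S \<in> sets (M \<Otimes>\<^sub>M M)"
  shows "cell_approximable S"
proof -
  have "S \<in> sigma_sets (space M \<times> space M) {a \<times> b | a b. a \<in> sets M \<and> b \<in> sets M}"
    using assms by (simp add: sets_pair_measure)
  then show ?thesis
  proof (induction rule: sigma_sets.induct)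
    case (Basic S)
    then obtain A B where AB: "S = A \<times> B" "A \<in> sets M" "B \<in> sets M" by auto
    define p :: "'a \<Rightarrow> nat" where "p x = prod_encode (if x \<in> A then 1 else 0, if x \<in> B then 1 else 0)" for x
    \<comment> \<open>A label carries one bit for \<open>A\<close> and one for \<open>B\<close>; the
      rectangle reads the \<open>A\<close> bit of the left point and the \<open>B\<close> bit of the
      right point.\<close>
    define R :: "(nat \<times> nat) set" where "R = {(i, j). fst (prod_decode i) = 1 \<and> snd (prod_decode j) = 1}"
    have "finite_partition_map M p"
      unfolding p_def by (intro finite_partition_map_prod_encode finite_partition_map_indicator AB)
    moreover have "cell_union (space M) p R = S"
      using AB(2,3)[THEN sets.sets_into_space] unfolding AB(1)
      by (auto simp: p_def R_def cell_union_def split: if_splits)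
    ultimately show ?case
      unfolding cell_approximable_def by (intro allI impI exI[of _ p] exI[of _ R]) simp
  next
    case Empty
    show ?case by (rule cell_approximable_empty)
  next
    case (Compl S)
    have "S \<in> sets (M \<Otimes>\<^sub>M M)"
      using Compl(1) by (simp add: sets_pair_measure)
    then have S: "S \<subseteq> space M \<times> space M"
      by (metis sets.sets_into_space space_pair_measure)
    show ?case
      unfolding cell_approximable_def
    proof (intro allI impI)
      fix e :: real assume "e > 0"
      then obtain p R where pR: "finite_partition_map M p"
        "measure (M \<Otimes>\<^sub>M M) (sym_diff S (cell_union (space M) p R)) < e"
        using Compl(2) by (auto simp: cell_approximable_def)
      moreover have "sym_diff (space M \<times> space M - S) (cell_union (space M) p (- R)) =
          sym_diff S (cell_union (space M) p R)"
        using S by (auto simp: cell_union_def)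
      ultimately show "\<exists>p R. finite_partition_map M p \<and>
          measure (M \<Otimes>\<^sub>M M) (sym_diff (space M \<times> space M - S) (cell_union (space M) p R)) < e"
        by (intro exI[of _ p] exI[of _ "- R"]) simp
    qed
  next
    case (Union A)
    have A: "A i \<in> sets (M \<Otimes>\<^sub>M M)" for i
      using Union(1) by (simp add: sets_pair_measure)
    show ?case
      unfolding cell_approximable_def
    proof (intro allI impI)
      fix e :: real assume "e > 0"
      \<comment> \<open>Continuity from below: finitely many of the sets exhaust the union up to
        \<open>e / 2\<close>, and the other half is spent on approximating that finite
        union.\<close>
      have "(\<lambda>k. measure (M \<Otimes>\<^sub>M M) (\<Union>i<k. A i)) \<longlonglongrightarrow> measure (M \<Otimes>\<^sub>M M) (\<Union>k. \<Union>i<k. A i)"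
        using A by (intro pair.P.finite_Lim_measure_incseq) (auto simp: incseq_def, force)
      also have "(\<Union>k. \<Union>i<k. A i) = (\<Union>i. A i)"
        by auto
      finally have "\<forall>\<^sub>F k in sequentially. measure (M \<Otimes>\<^sub>M M) (\<Union>i. A i) - e / 2 < measure (M \<Otimes>\<^sub>M M) (\<Union>i<k. A i)"
        using \<open>e > 0\<close> by (intro order_tendstoD) auto
      then obtain k where k: "measure (M \<Otimes>\<^sub>M M) (\<Union>i. A i) - e / 2 < measure (M \<Otimes>\<^sub>M M) (\<Union>i<k. A i)"
        by (auto simp: eventually_sequentially)
      obtain p R where pR: "finite_partition_map M p"
        "measure (M \<Otimes>\<^sub>M M) (sym_diff (\<Union>i<k. A i) (cell_union (space M) p R)) < e / 2"
        using cell_approximable_UN_lessThan[of A k] Union(2) A \<open>e > 0\<close>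
        unfolding cell_approximable_def by (meson half_gt_zero)
      have "measure (M \<Otimes>\<^sub>M M) (sym_diff (\<Union>i. A i) (cell_union (space M) p R)) \<le>
        measure (M \<Otimes>\<^sub>M M) (((\<Union>i. A i) - (\<Union>i<k. A i)) \<union> sym_diff (\<Union>i<k. A i) (cell_union (space M) p R))"
        using A sets_cell_union[OF pR(1)] by (intro pair.P.finite_measure_mono) auto
      also have "\<dots> \<le> measure (M \<Otimes>\<^sub>M M) ((\<Union>i. A i) - (\<Union>i<k. A i)) +
          measure (M \<Otimes>\<^sub>M M) (sym_diff (\<Union>i<k. A i) (cell_union (space M) p R))"
        using A sets_cell_union[OF pR(1)] by (intro measure_Un_le) auto
      also have "measure (M \<Otimes>\<^sub>M M) ((\<Union>i. A i) - (\<Union>i<k. A i)) =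
          measure (M \<Otimes>\<^sub>M M) (\<Union>i. A i) - measure (M \<Otimes>\<^sub>M M) (\<Union>i<k. A i)"
        using A by (intro pair.P.finite_measure_Diff) auto
      finally show "\<exists>p R. finite_partition_map M p \<and>
          measure (M \<Otimes>\<^sub>M M) (sym_diff (\<Union>i. A i) (cell_union (space M) p R)) < e"
        using k pR by (intro exI[of _ p] exI[of _ R]) simp
    qed
  qed
qed

end

text \<open>Distinct label pairs give disjoint rectangles. The value is a polynomial in finitely
  many cell masses, which is why it can be computed from color frequencies and passes to setwise
  limits of measures.\<close>

lemma measure_cell_union:
  assumes "finite_measure \<mu>" "sets \<mu> = sets M" "finite_partition_map M p"
  shows "measure (\<mu> \<Otimes>\<^sub>M \<mu>) (cell_union (space M) p R) =
    (\<Sum>(i, j)\<in>R \<inter> (p ` space M \<times> p ` space M).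
      measure \<mu> (p -` {i} \<inter> space M) * measure \<mu> (p -` {j} \<inter> space M))"
proof -
  interpret finite_measure \<mu> by fact
  interpret pair: finite_measure "\<mu> \<Otimes>\<^sub>M \<mu>"
    by (intro finite_measure_pair_measure assms)
  let ?c = "\<lambda>i. p -` {i} \<inter> space M"
  let ?J = "R \<inter> (p ` space M \<times> p ` space M)"
  have c: "?c i \<in> sets \<mu>" for i
    using sets_cell[OF assms(3)] by (simp add: assms(2))
  have "cell_union (space M) p R = (\<Union>z\<in>?J. ?c (fst z) \<times> ?c (snd z))"
    by (auto simp: cell_union_def)
  also have "measure (\<mu> \<Otimes>\<^sub>M \<mu>) \<dots> = (\<Sum>z\<in>?J. measure (\<mu> \<Otimes>\<^sub>M \<mu>) (?c (fst z) \<times> ?c (snd z)))"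
    using assms(3) c by (intro pair.finite_measure_finite_Union)
      (auto simp: finite_partition_map_def disjoint_family_on_def)
  also have "\<dots> = (\<Sum>z\<in>?J. measure \<mu> (?c (fst z)) * measure \<mu> (?c (snd z)))"
    using c by (simp add: measure_def emeasure_pair_measure_Times enn2real_mult)
  finally show ?thesis
    by (simp add: case_prod_beta')
qed

lemma sum_Times_Times:
  fixes \<phi> :: "'i \<times> 'j \<Rightarrow> 'i \<times> 'j \<Rightarrow> 'b :: comm_monoid_add"
  shows "(\<Sum>i\<in>Q \<times> L. \<Sum>j\<in>Q \<times> L. \<phi> i j) = (\<Sum>q\<in>Q. \<Sum>q'\<in>Q. \<Sum>l\<in>L. \<Sum>l'\<in>L. \<phi> (q, l) (q', l'))"
proof -
  have "(\<Sum>i\<in>Q \<times> L. \<Sum>j\<in>Q \<times> L. \<phi> i j) = (\<Sum>q\<in>Q. \<Sum>l\<in>L. \<Sum>q'\<in>Q. \<Sum>l'\<in>L. \<phi> (q, l) (q', l'))"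
    by (simp add: sum.cartesian_product')
  also have "\<dots> = (\<Sum>q\<in>Q. \<Sum>q'\<in>Q. \<Sum>l\<in>L. \<Sum>l'\<in>L. \<phi> (q, l) (q', l'))"
    by (intro sum.cong refl sum.swap)
  finally show ?thesis .
qed

context prob_space
begin

interpretation pair: pair_prob_space M M ..

lemma pair_uniform_measure:
  assumes "A \<in> sets M" "B \<in> sets M" "prob A > 0" "prob B > 0"
  shows "uniform_measure M A \<Otimes>\<^sub>M uniform_measure M B = uniform_measure (M \<Otimes>\<^sub>M M) (A \<times> B)"
proof (rule pair_measure_eqI)
  show "sigma_finite_measure (uniform_measure M A)" "sigma_finite_measure (uniform_measure M B)"
    using assms emeasure_eq_measure
    by (auto intro!: prob_space_imp_sigma_finite prob_space_uniform_measure)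
next
  fix C D assume "C \<in> sets (uniform_measure M A)" "D \<in> sets (uniform_measure M B)"
  then show "emeasure (uniform_measure M A) C * emeasure (uniform_measure M B) D =
      emeasure (uniform_measure (M \<Otimes>\<^sub>M M) (A \<times> B)) (C \<times> D)"
    using assms
    by (simp add: Times_Int_Times emeasure_pair_measure_Times emeasure_eq_measure
        divide_ennreal ennreal_mult[symmetric] mult_pos_pos)
qed (simp cong: sets_pair_measure_cong)

lemma prob_cells_sum:
  assumes "finite_partition_map M p"
  shows "(\<Sum>q\<in>p ` space M. prob (p -` {q} \<inter> space M)) = 1"
proof -
  have "(\<Sum>q\<in>p ` space M. prob (p -` {q} \<inter> space M)) = prob (\<Union>q\<in>p ` space M. p -` {q} \<inter> space M)"
    using assms sets_cell[OF assms]
    by (intro finite_measure_finite_Union[symmetric])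
      (auto simp: finite_partition_map_def disjoint_family_on_def)
  also have "(\<Union>q\<in>p ` space M. p -` {q} \<inter> space M) = space M"
    by auto
  finally show ?thesis by (simp add: prob_space)
qed

lemma measure_Int_cell_union:
  assumes "finite_partition_map M p" "Z \<in> sets (M \<Otimes>\<^sub>M M)"
  shows "measure (M \<Otimes>\<^sub>M M) (Z \<inter> cell_union (space M) p R) =
    (\<Sum>q\<in>p ` space M. \<Sum>q'\<in>p ` space M. if (q, q') \<in> R
      then measure (M \<Otimes>\<^sub>M M) (Z \<inter> ((p -` {q} \<inter> space M) \<times> (p -` {q'} \<inter> space M))) else 0)"
proof -
  let ?c = "\<lambda>i. p -` {i} \<inter> space M"
  let ?J = "R \<inter> (p ` space M \<times> p ` space M)"
  have fin: "finite (p ` space M)"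
    using assms(1) by (simp add: finite_partition_map_def)
  have "Z \<inter> cell_union (space M) p R = (\<Union>z\<in>?J. Z \<inter> (?c (fst z) \<times> ?c (snd z)))"
    by (auto simp: cell_union_def)
  also have "measure (M \<Otimes>\<^sub>M M) \<dots> = (\<Sum>z\<in>?J. measure (M \<Otimes>\<^sub>M M) (Z \<inter> (?c (fst z) \<times> ?c (snd z))))"
    using fin sets_cell[OF assms(1)] assms(2)
    by (intro pair.P.finite_measure_finite_Union) (auto simp: disjoint_family_on_def)
  also have "\<dots> = (\<Sum>z\<in>p ` space M \<times> p ` space M. if z \<in> R
      then measure (M \<Otimes>\<^sub>M M) (Z \<inter> (?c (fst z) \<times> ?c (snd z))) else 0)"
    using fin by (subst sum.inter_restrict[symmetric]) (auto simp: Int_commute)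
  finally show ?thesis
    by (simp add: sum.cartesian_product case_prod_beta')
qed

text \<open>A sample with \<^term>\<open>L :: nat\<close> points in each cell has its cell frequencies prescribed, so that only a
  first moment has to be computed.\<close>

lemma ex_stratified_sample:
  fixes L :: nat and R :: "(nat \<times> nat) set"
  assumes p: "finite_partition_map M p" and Z: "Z \<in> sets (M \<Otimes>\<^sub>M M)"
  defines "Q \<equiv> p ` space M" and "w \<equiv> \<lambda>q. prob (p -` {q} \<inter> space M)"
  assumes AE: "AE x in (\<Pi>\<^sub>M i\<in>Q \<times> {..<L}. M). P x"
  shows "\<exists>x\<in>Q \<times> {..<L} \<rightarrow> space M. P x \<and>
    (\<Sum>i\<in>Q \<times> {..<L}. \<Sum>j\<in>Q \<times> {..<L}. if i \<noteq> j \<and> (fst i, fst j) \<in> R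
      then w (fst i) * w (fst j) * indicator Z (x i, x j) else 0)
    \<le> (real L)\<^sup>2 * measure (M \<Otimes>\<^sub>M M) (Z \<inter> cell_union (space M) p R)"
proof (rule ccontr)
  assume contra: "\<not> ?thesis"
  define c where "c q = p -` {q} \<inter> space M" for q
  \<comment> \<open>A null cell has no uniform measure, so the whole space stands in for it. This is
    harmless because every term with such a cell has weight 0.\<close>
  define A where "A q = (if 0 < w q then c q else space M)" for q
  define I where "I = Q \<times> {..<L}"
  define K where "K i = uniform_measure M (A (fst i))" for i :: "nat \<times> nat"
  define h where "h i j x = (if i \<noteq> j \<and> (fst i, fst j) \<in> R
      then w (fst i) * w (fst j) * indicator Z (x i, x j) else 0)"
    for i j :: "nat \<times> nat" and x :: "nat \<times> nat \<Rightarrow> 'a"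
  have fin: "finite Q" "finite I"
    using p by (auto simp: finite_partition_map_def Q_def I_def)
  have c: "c q \<in> sets M" for q
    unfolding c_def by (rule sets_cell[OF p])
  have w_eq: "w q = prob (c q)" for q
    by (simp add: w_def c_def)
  have A: "A q \<in> sets M" "0 < prob (A q)" for q
    using c by (auto simp: A_def w_eq prob_space)
  have K: "prob_space (K i)" for i
    unfolding K_def using A[of "fst i"] by (intro prob_space_uniform_measure) (auto simp: emeasure_eq_measure)
  interpret PK: prob_space "Pi\<^sub>M I K"
    using K by (intro prob_space_PiM)
  have sets_K[measurable_cong]: "sets (K i) = sets M" for i
    by (simp add: K_def)
  have pairK: "(\<lambda>x. (x i, x j)) \<in> Pi\<^sub>M I K \<rightarrow>\<^sub>M K i \<Otimes>\<^sub>M K j" if "i \<in> I" "j \<in> I" for i j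
    using that by simp
  have sets_pairK: "sets (K i \<Otimes>\<^sub>M K j) = sets (M \<Otimes>\<^sub>M M)" for i j
    by (intro sets_pair_measure_cong sets_K)
  \<comment> \<open>Off the diagonal, in cells of positive mass, the weights cancel the
    normalization of the two uniform measures and equality holds. The inequality accommodates the
    diagonal, where \<open>h\<close> is 0.\<close>
  have E_le: "PK.expectation (h i j) \<le> (if (fst i, fst j) \<in> R
      then measure (M \<Otimes>\<^sub>M M) (Z \<inter> (c (fst i) \<times> c (fst j))) else 0)"
    and int: "integrable (Pi\<^sub>M I K) (h i j)" if ij: "i \<in> I" "j \<in> I" for i j
  proof -
    let ?ind = "\<lambda>x. indicator Z (x i, x j) :: real"
    have meas: "?ind \<in> borel_measurable (Pi\<^sub>M I K)"
      using Z sets_pairK by (intro measurable_compose[OF pairK[OF ij] borel_measurable_indicator]) simp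
    then have int_ind: "integrable (Pi\<^sub>M I K) ?ind"
      by (intro PK.integrable_const_bound[where B = 1]) auto
    then show "integrable (Pi\<^sub>M I K) (h i j)"
      unfolding h_def by (cases "i \<noteq> j \<and> (fst i, fst j) \<in> R") auto
    show "PK.expectation (h i j) \<le> (if (fst i, fst j) \<in> R
      then measure (M \<Otimes>\<^sub>M M) (Z \<inter> (c (fst i) \<times> c (fst j))) else 0)"
    proof (cases "i \<noteq> j \<and> (fst i, fst j) \<in> R \<and> 0 < w (fst i) \<and> 0 < w (fst j)")
      case True
      have "PK.expectation ?ind = integral\<^sup>L (distr (Pi\<^sub>M I K) (K i \<Otimes>\<^sub>M K j) (\<lambda>x. (x i, x j))) (indicator Z)"
        using Z sets_pairK by (intro integral_distr[symmetric] pairK ij) simp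
      also have "\<dots> = measure (K i \<Otimes>\<^sub>M K j) Z"
        using True ij K Z sets_pairK sets.sets_into_space[OF Z] sets_eq_imp_space_eq[OF sets_pairK]
        by (simp add: distr_PiM_pair Int_absorb2)
      also have "K i \<Otimes>\<^sub>M K j = uniform_measure (M \<Otimes>\<^sub>M M) (c (fst i) \<times> c (fst j))"
        using True c unfolding K_def A_def w_eq by (simp add: pair_uniform_measure)
      also have "measure \<dots> Z = measure (M \<Otimes>\<^sub>M M) (Z \<inter> (c (fst i) \<times> c (fst j))) / (w (fst i) * w (fst j))"
      proof -
        have "measure (M \<Otimes>\<^sub>M M) (c (fst i) \<times> c (fst j)) = w (fst i) * w (fst j)"
          using c by (simp add: measure_def emeasure_pair_measure_Times enn2real_mult w_eq)
        then show ?thesis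
          using Z c True
          by (subst measure_uniform_measure) (auto simp: pair.P.emeasure_eq_measure Int_commute)
      qed
      finally have "PK.expectation ?ind =
        measure (M \<Otimes>\<^sub>M M) (Z \<inter> (c (fst i) \<times> c (fst j))) / (w (fst i) * w (fst j))" .
      moreover have "h i j = (\<lambda>x. w (fst i) * w (fst j) * indicator Z (x i, x j))"
        using True by (simp add: h_def fun_eq_iff)
      ultimately show ?thesis
        using True by simp
    next
      case False
      moreover have "0 \<le> w q" for q by (simp add: w_eq)
      ultimately have "h i j = (\<lambda>_. 0)"
        unfolding h_def by (fastforce simp: fun_eq_iff less_le)
      then show ?thesis by simp
    qed
  qed
  have "AE x in Pi\<^sub>M I K. P x"
    unfolding K_def
  proof (intro AE_PiM_uniform_measure prob_space_axioms fin A)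
    show "emeasure M (A (fst i)) \<noteq> 0" for i
      using A(2)[of "fst i"] by (simp add: emeasure_eq_measure)
    show "AE x in (\<Pi>\<^sub>M i\<in>I. M). P x"
      using AE unfolding I_def .
  qed
  \<comment> \<open>By \<open>contra\<close>, every sample satisfying \<open>P\<close> exceeds the
    bound, hence so does the expectation; but the expectation is at most that very bound.\<close>
  then have "AE x in Pi\<^sub>M I K. (real L)\<^sup>2 * measure (M \<Otimes>\<^sub>M M) (Z \<inter> cell_union (space M) p R)
      < (\<Sum>i\<in>I. \<Sum>j\<in>I. h i j x)"
  proof (rule AE_mp, intro AE_I2 impI)
    fix x assume "x \<in> space (Pi\<^sub>M I K)" "P x"
    moreover have "space (K i) = space M" for i
      by (simp add: K_def)
    ultimately have "x \<in> Q \<times> {..<L} \<rightarrow> space M" "P x"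
      by (auto simp: space_PiM I_def)
    with contra show "(real L)\<^sup>2 * measure (M \<Otimes>\<^sub>M M) (Z \<inter> cell_union (space M) p R)
      < (\<Sum>i\<in>I. \<Sum>j\<in>I. h i j x)"
      unfolding h_def I_def not_le[symmetric] by blast
  qed
  then have "(real L)\<^sup>2 * measure (M \<Otimes>\<^sub>M M) (Z \<inter> cell_union (space M) p R)
      < PK.expectation (\<lambda>x. \<Sum>i\<in>I. \<Sum>j\<in>I. h i j x)"
    using int by (intro PK.expectation_greater Bochner_Integration.integrable_sum)
  also have "\<dots> = (\<Sum>i\<in>I. \<Sum>j\<in>I. PK.expectation (h i j))"
    using int by (subst Bochner_Integration.integral_sum;
      (intro sum.cong refl Bochner_Integration.integral_sum Bochner_Integration.integrable_sum)?)
  also have "\<dots> \<le> (\<Sum>i\<in>I. \<Sum>j\<in>I. if (fst i, fst j) \<in> R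
      then measure (M \<Otimes>\<^sub>M M) (Z \<inter> (c (fst i) \<times> c (fst j))) else 0)"
    by (intro sum_mono E_le)
  \<comment> \<open>Each pair of cells is met by \<open>L * L\<close> pairs of positions.\<close>
  also have "\<dots> = (real L)\<^sup>2 * measure (M \<Otimes>\<^sub>M M) (Z \<inter> cell_union (space M) p R)"
    unfolding I_def sum_Times_Times measure_Int_cell_union[OF p Z] c_def Q_def
    unfolding sum_distrib_left by (intro sum.cong refl) (simp add: power2_eq_square)
  finally show False by simp
qed

end

section \<open>Fractional colorings from stratified samples\<close>

definition fractional_coloring :: "'a measure \<Rightarrow> nat \<Rightarrow> (nat \<Rightarrow> 'a measure) \<Rightarrow> bool" where
  "fractional_coloring M r \<mu> \<longleftrightarrow>
     (\<forall>k<r. finite_measure (\<mu> k) \<and> sets (\<mu> k) = sets M) \<and>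
     (\<forall>A\<in>sets M. (\<Sum>k<r. measure (\<mu> k) A) = measure M A)"

lemma fractional_coloring_le:
  assumes "fractional_coloring M r \<mu>" "k < r" "A \<in> sets M"
  shows "measure (\<mu> k) A \<le> measure M A"
proof -
  have "measure (\<mu> k) A \<le> (\<Sum>k<r. measure (\<mu> k) A)"
    using assms(2) by (intro member_le_sum) auto
  then show ?thesis
    using assms by (simp add: fractional_coloring_def)
qed

context prob_space
begin

interpretation pair: pair_prob_space M M ..

text \<open>Domination is used twice in the iterated integral: inside, for the slices, and outside,
  for the measure integrated against. It makes error sets at most as large for a color as for
  \<open>M\<close>.\<close>

lemma measure_pair_mono:
  assumes "finite_measure \<mu>" and sets: "sets \<mu> = sets M"
    and le: "\<And>A. A \<in> sets M \<Longrightarrow> measure \<mu> A \<le> prob A"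
    and X: "X \<in> sets (M \<Otimes>\<^sub>M M)"
  shows "measure (\<mu> \<Otimes>\<^sub>M \<mu>) X \<le> measure (M \<Otimes>\<^sub>M M) X"
proof -
  interpret \<mu>: finite_measure \<mu> by fact
  interpret pair_\<mu>: finite_measure "\<mu> \<Otimes>\<^sub>M \<mu>"
    by (intro finite_measure_pair_measure assms)
  have le_emeasure: "emeasure \<mu> A \<le> emeasure M A" for A
  proof (cases "A \<in> sets M")
    case True
    then show ?thesis
      using le[of A] by (simp add: \<mu>.emeasure_eq_measure emeasure_eq_measure)
  next
    case False
    then show ?thesis
      by (simp add: sets emeasure_notin_sets)
  qed
  have "emeasure (\<mu> \<Otimes>\<^sub>M \<mu>) X = (\<integral>\<^sup>+x. emeasure \<mu> (Pair x -` X) \<partial>\<mu>)"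
    using X sets by (intro \<mu>.emeasure_pair_measure_alt) (simp cong: sets_pair_measure_cong)
  also have "\<dots> \<le> (\<integral>\<^sup>+x. emeasure M (Pair x -` X) \<partial>\<mu>)"
    by (intro nn_integral_mono le_emeasure)
  also have "\<dots> \<le> (\<integral>\<^sup>+x. emeasure M (Pair x -` X) \<partial>M)"
    using sets le_emeasure
    by (intro nn_integral_mono_measure) (auto simp: le_measure le_fun_def)
  also have "\<dots> = emeasure (M \<Otimes>\<^sub>M M) X"
    using X by (intro emeasure_pair_measure_alt[symmetric])
  finally show ?thesis
    by (simp add: pair_\<mu>.emeasure_eq_measure pair.P.emeasure_eq_measure)
qed

text \<open>\<open>F k q\<close> is the share of cell \<open>q\<close> that goes to color
  \<open>k\<close>. Spreading each share evenly over its cell, by a density constant on cells, turns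
  frequencies into measures.\<close>

lemma fractional_coloring_density:
  assumes p: "finite_partition_map M p"
    and F: "\<And>k q. 0 \<le> F k q" "\<And>q. q \<in> p ` space M \<Longrightarrow> (\<Sum>k<r. F k q) = (1 :: real)"
  shows "fractional_coloring M r (\<lambda>k. density M (\<lambda>y. ennreal (F k (p y))))"
    and "k < r \<Longrightarrow> measure (density M (\<lambda>y. ennreal (F k (p y)))) (p -` {q} \<inter> space M) =
      F k q * prob (p -` {q} \<inter> space M)"
proof -
  let ?\<mu> = "\<lambda>k. density M (\<lambda>y. ennreal (F k (p y)))"
  have [measurable]: "p \<in> M \<rightarrow>\<^sub>M count_space UNIV"
    using p by (simp add: finite_partition_map_def)
  have [measurable]: "(\<lambda>y. ennreal (F k (p y))) \<in> borel_measurable M" for k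
    by measurable
  have sum: "(\<Sum>k<r. emeasure (?\<mu> k) A) = emeasure M A" if A: "A \<in> sets M" for A
  proof -
    have "(\<Sum>k<r. emeasure (?\<mu> k) A) = (\<integral>\<^sup>+y. (\<Sum>k<r. ennreal (F k (p y)) * indicator A y) \<partial>M)"
      using A by (subst nn_integral_sum) (auto simp: emeasure_density)
    also have "\<dots> = (\<integral>\<^sup>+y. indicator A y \<partial>M)"
      unfolding sum_distrib_right[symmetric]
      using F by (intro nn_integral_cong) (simp add: sum_ennreal)
    finally show ?thesis
      using A by simp
  qed
  have fin: "finite_measure (?\<mu> k)" if "k < r" for k
  proof
    have "emeasure (?\<mu> k) (space M) \<le> (\<Sum>k<r. emeasure (?\<mu> k) (space M))"
      using that by (intro member_le_sum) auto
    also have "\<dots> = 1"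
      using sum[OF sets.top] by (simp only: emeasure_space_1)
    finally have "emeasure (?\<mu> k) (space M) < \<infinity>"
      by (rule le_less_trans) simp
    then show "emeasure (?\<mu> k) (space (?\<mu> k)) \<noteq> \<infinity>"
      unfolding space_density by (rule less_imp_neq)
  qed
  have "(\<Sum>k<r. measure (?\<mu> k) A) = prob A" if A: "A \<in> sets M" for A
  proof -
    have "(\<Sum>k<r. emeasure (?\<mu> k) A) = (\<Sum>k<r. ennreal (measure (?\<mu> k) A))"
      by (intro sum.cong refl finite_measure.emeasure_eq_measure fin) simp
    then have "ennreal (\<Sum>k<r. measure (?\<mu> k) A) = ennreal (prob A)"
      using sum[OF A] by (simp add: sum_ennreal emeasure_eq_measure)
    then show ?thesis
      by (simp add: sum_nonneg)
  qed
  with fin show "fractional_coloring M r ?\<mu>"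
    unfolding fractional_coloring_def by simp
  assume "k < r"
  let ?c = "p -` {q} \<inter> space M"
  have "emeasure (?\<mu> k) ?c = (\<integral>\<^sup>+y. ennreal (F k (p y)) * indicator ?c y \<partial>M)"
    using sets_cell[OF p] by (simp add: emeasure_density)
  also have "\<dots> = (\<integral>\<^sup>+y. ennreal (F k q) * indicator ?c y \<partial>M)"
    by (intro nn_integral_cong) (auto simp: indicator_def)
  also have "\<dots> = ennreal (F k q) * emeasure M ?c"
    using sets_cell[OF p] by (simp add: nn_integral_cmult_indicator)
  finally show "measure (?\<mu> k) ?c = F k q * prob ?c"
    using F(1)[of k q] by (simp add: measure_def enn2real_mult)
qed

end

lemma sum_le_off_diagonal_plus_diagonal:
  fixes \<phi> \<psi> :: "'i \<Rightarrow> 'i \<Rightarrow> real"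
  assumes "finite I" "\<And>i j. i \<in> I \<Longrightarrow> j \<in> I \<Longrightarrow> i \<noteq> j \<Longrightarrow> \<phi> i j \<le> \<psi> i j"
    and "\<And>i. i \<in> I \<Longrightarrow> \<phi> i i \<le> \<psi> i i + d i"
  shows "(\<Sum>i\<in>I. \<Sum>j\<in>I. \<phi> i j) \<le> (\<Sum>i\<in>I. \<Sum>j\<in>I. \<psi> i j) + (\<Sum>i\<in>I. d i)"
proof -
  have "(\<Sum>i\<in>I. \<Sum>j\<in>I. \<phi> i j) \<le> (\<Sum>i\<in>I. \<Sum>j\<in>I. \<psi> i j + (if j = i then d i else 0))"
    using assms(2,3) by (intro sum_mono) auto
  also have "\<dots> = (\<Sum>i\<in>I. \<Sum>j\<in>I. \<psi> i j) + (\<Sum>i\<in>I. d i)"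
    using assms(1) by (simp add: sum.distrib sum.delta)
  finally show ?thesis .
qed

context graphon_space
begin

definition "support = {z \<in> space (M \<Otimes>\<^sub>M M). W (fst z) (snd z) \<noteq> 0}"

lemma sets_support [measurable]: "support \<in> sets (M \<Otimes>\<^sub>M M)"
  unfolding support_def by measurable

text \<open>Up to the factor \<open>L\<close> squared, the mass of the cell union under color
  \<open>k\<close> is a weighted count of pairs of sample points of color \<open>k\<close> assigned
  to cells related by \<open>R\<close>. Two distinct such points form a pair outside the support,
  and the stratified sample bounds the weighted count of those pairs by the mass of the cell union
  outside the support. A point paired with itself escapes this argument; these pairs cost
  \<open>1 / L\<close>.\<close>

lemma ex_fractional_coloring_cell_union:
  fixes L :: nat
  assumes sp: "subgraph_perfect M W" "\<And>s. 0 < hom_density s (complete_edges s) M W \<Longrightarrow> s \<le> r"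
    and p: "finite_partition_map M p" and L: "L > 0"
  shows "\<exists>\<mu>. fractional_coloring M r \<mu> \<and> (\<forall>k<r. measure (\<mu> k \<Otimes>\<^sub>M \<mu> k) (cell_union (space M) p R) \<le>
    measure (M \<Otimes>\<^sub>M M) (cell_union (space M) p R - support) + 1 / L)"
proof -
  define Q where "Q = p ` space M"
  define I where "I = Q \<times> {..<L}"
  define w where "w q = prob (p -` {q} \<inter> space M)" for q
  define Z where "Z = space (M \<Otimes>\<^sub>M M) - support"
  have fin: "finite Q" "finite I"
    using p by (auto simp: finite_partition_map_def Q_def I_def)
  have Z: "Z \<in> sets (M \<Otimes>\<^sub>M M)" by (simp add: Z_def)
  let ?few = "\<lambda>x. (\<Sum>i\<in>I. \<Sum>j\<in>I. if i \<noteq> j \<and> (fst i, fst j) \<in> R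
        then w (fst i) * w (fst j) * indicator Z (x i, x j) else 0)
      \<le> (real L)\<^sup>2 * measure (M \<Otimes>\<^sub>M M) (Z \<inter> cell_union (space M) p R)"
  have "\<exists>x\<in>I \<rightarrow> space M. (\<exists>c\<in>I \<rightarrow> {..<r}.
      \<forall>i\<in>I. \<forall>j\<in>I. i \<noteq> j \<longrightarrow> W (x i) (x j) \<noteq> 0 \<longrightarrow> c i \<noteq> c j) \<and> ?few x"
    unfolding I_def Q_def w_def
    by (rule ex_stratified_sample[OF p Z AE_sample_colorable[OF sp]])
      (assumption, rule fin(2)[unfolded I_def Q_def])
  then obtain x where x: "x \<in> I \<rightarrow> space M"
    and x': "(\<exists>c\<in>I \<rightarrow> {..<r}. \<forall>i\<in>I. \<forall>j\<in>I. i \<noteq> j \<longrightarrow> W (x i) (x j) \<noteq> 0 \<longrightarrow> c i \<noteq> c j) \<and> ?few x" ..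
  note few = x'[THEN conjunct2]
  from x'[THEN conjunct1] obtain c where c: "c \<in> I \<rightarrow> {..<r}"
      "\<forall>i\<in>I. \<forall>j\<in>I. i \<noteq> j \<longrightarrow> W (x i) (x j) \<noteq> 0 \<longrightarrow> c i \<noteq> c j" ..
  \<comment> \<open>Frequencies are counted by the index \<open>q\<close>; where
    \<open>x (q, l)\<close> lies enters only through \<open>few\<close> and the properness of
    \<open>c\<close>.\<close>
  define F where "F k q = (\<Sum>l<L. if c (q, l) = k then 1 else 0) / real L" for k q
  define \<mu> where "\<mu> k = density M (\<lambda>y. ennreal (F k (p y)))" for k
  have F_nonneg: "0 \<le> F k q" for k q
    by (simp add: F_def sum_nonneg)
  have F_sum: "(\<Sum>k<r. F k q) = 1" if "q \<in> Q" for q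
  proof -
    have "(\<Sum>k<r. F k q) = (\<Sum>l<L. \<Sum>k<r. if c (q, l) = k then 1 else 0) / real L"
      unfolding F_def sum_divide_distrib[symmetric] by (subst sum.swap) (rule refl)
    also have "(\<Sum>l<L. \<Sum>k<r. if c (q, l) = k then 1 else 0) = (\<Sum>l<L. 1 :: real)"
    proof (intro sum.cong refl)
      fix l assume "l \<in> {..<L}"
      then have "c (q, l) < r"
        using that c(1) by (auto simp: I_def)
      then show "(\<Sum>k<r. if c (q, l) = k then 1 else 0) = (1 :: real)"
        by simp
    qed
    finally show ?thesis
      using L by simp
  qed
  have frac: "fractional_coloring M r \<mu>"
    and cell: "\<And>k q. k < r \<Longrightarrow> measure (\<mu> k) (p -` {q} \<inter> space M) = F k q * w q"
    unfolding \<mu>_def w_def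
    by (rule fractional_coloring_density[OF p, where F = F]; simp add: F_nonneg F_sum flip: Q_def)+
  have "measure (\<mu> k \<Otimes>\<^sub>M \<mu> k) (cell_union (space M) p R) \<le>
      measure (M \<Otimes>\<^sub>M M) (cell_union (space M) p R - support) + 1 / L" if k: "k < r" for k
  proof -
    define a where "a i = (if c i = k then w (fst i) else 0)" for i
    have Fw: "real L * (F k q * w q) = (\<Sum>l<L. a (q, l))" for q
      unfolding F_def a_def using L by (auto simp: sum_distrib_right intro!: sum.cong)
    have "(real L)\<^sup>2 * measure (\<mu> k \<Otimes>\<^sub>M \<mu> k) (cell_union (space M) p R) =
      (real L)\<^sup>2 * (\<Sum>(i, j)\<in>R \<inter> (Q \<times> Q). (F k i * w i) * (F k j * w j))"
      using frac k p by (subst measure_cell_union) (auto simp: fractional_coloring_def cell Q_def)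
    also have "\<dots> = (\<Sum>(i, j)\<in>R \<inter> (Q \<times> Q). (real L * (F k i * w i)) * (real L * (F k j * w j)))"
      unfolding sum_distrib_left by (intro sum.cong) (auto simp: power2_eq_square)
    also have "\<dots> = (\<Sum>z\<in>Q \<times> Q. if z \<in> R then
        (real L * (F k (fst z) * w (fst z))) * (real L * (F k (snd z) * w (snd z))) else 0)"
      using fin by (subst sum.inter_restrict[symmetric]) (auto simp: Int_commute case_prod_beta')
    also have "\<dots> = (\<Sum>q\<in>Q. \<Sum>q'\<in>Q. \<Sum>l<L. \<Sum>l'<L. if (q, q') \<in> R then a (q, l) * a (q', l') else 0)"
      unfolding Fw by (auto simp: sum.cartesian_product' sum_product intro!: sum.cong)
    also have "\<dots> = (\<Sum>i\<in>I. \<Sum>j\<in>I. if (fst i, fst j) \<in> R then a i * a j else 0)"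
      unfolding I_def sum_Times_Times by simp
    also have "\<dots> \<le> (\<Sum>i\<in>I. \<Sum>j\<in>I. if i \<noteq> j \<and> (fst i, fst j) \<in> R
        then w (fst i) * w (fst j) * indicator Z (x i, x j) else 0) + (\<Sum>i\<in>I. w (fst i))"
    proof (rule sum_le_off_diagonal_plus_diagonal[OF fin(2)])
      fix i j assume ij: "i \<in> I" "j \<in> I" "i \<noteq> j"
      have "(x i, x j) \<in> Z" if "c i = k" "c j = k"
        using c(2)[THEN bspec, OF ij(1), THEN bspec, OF ij(2)] that ij x
        by (auto simp: Z_def support_def space_pair_measure)
      then show "(if (fst i, fst j) \<in> R then a i * a j else 0) \<le> (if i \<noteq> j \<and> (fst i, fst j) \<in> R
        then w (fst i) * w (fst j) * indicator Z (x i, x j) else 0)"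
        using ij(3) by (auto simp: a_def w_def)
    next
      fix i :: "nat \<times> nat"
      \<comment> \<open>Weights are at most 1, so the diagonal adds at most the sum of
        \<open>w (fst i)\<close> over \<open>I\<close>, which is \<open>L\<close>; division by
        \<open>L\<close> squared leaves \<open>1 / L\<close>.\<close>
      have "w (fst i) * w (fst i) \<le> w (fst i)"
        by (simp add: w_def mult_left_le)
      then show "(if (fst i, fst i) \<in> R then a i * a i else 0) \<le> (if i \<noteq> i \<and> (fst i, fst i) \<in> R
        then w (fst i) * w (fst i) * indicator Z (x i, x i) else 0) + w (fst i)"
        by (auto simp: a_def w_def)
    qed
    also have "(\<Sum>i\<in>I. w (fst i)) = real L * (\<Sum>q\<in>Q. w q)"
      unfolding I_def by (simp add: sum.cartesian_product' sum_distrib_left)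
    also have "(\<Sum>q\<in>Q. w q) = 1"
      unfolding w_def Q_def by (rule prob_cells_sum[OF p])
    finally have "(real L)\<^sup>2 * measure (\<mu> k \<Otimes>\<^sub>M \<mu> k) (cell_union (space M) p R) \<le>
        (real L)\<^sup>2 * measure (M \<Otimes>\<^sub>M M) (Z \<inter> cell_union (space M) p R) + real L"
      using few by simp
    moreover have "Z \<inter> cell_union (space M) p R = cell_union (space M) p R - support"
      by (auto simp: Z_def cell_union_def space_pair_measure)
    ultimately have "(real L)\<^sup>2 * measure (\<mu> k \<Otimes>\<^sub>M \<mu> k) (cell_union (space M) p R) \<le>
        (real L)\<^sup>2 * (measure (M \<Otimes>\<^sub>M M) (cell_union (space M) p R - support) + 1 / L)"
      using L by (simp add: power2_eq_square distrib_left)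
    then show ?thesis
      using L by simp
  qed
  with frac show ?thesis by blast
qed

end

section \<open>Passing to the limit\<close>

text \<open>The index type may be uncountable, in which case the cube is compact by Tychonoff but
  need not be sequentially compact. A filter below \<open>sequentially\<close> therefore takes the
  place of a subsequence.\<close>

lemma ex_pointwise_convergent_subfilter:
  fixes \<phi> :: "nat \<Rightarrow> 'i \<Rightarrow> real"
  assumes "\<And>n i. \<phi> n i \<in> {0..1}"
  obtains G \<psi> where "G \<noteq> bot" "G \<le> sequentially" "\<And>i. ((\<lambda>n. \<phi> n i) \<longlongrightarrow> \<psi> i) G"
proof -
  have "compactin (product_topology (\<lambda>_. euclidean) UNIV) (PiE UNIV (\<lambda>_ :: 'i. {0..1 :: real}))"
    by (subst compactin_PiE) simp
  then have "compact (PiE UNIV (\<lambda>_ :: 'i. {0..1 :: real}))"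
    unfolding euclidean_product_topology by simp
  moreover have "\<forall>\<^sub>F y in filtermap \<phi> sequentially. y \<in> PiE UNIV (\<lambda>_. {0..1})"
    using assms by (simp add: eventually_filtermap PiE_UNIV_domain Pi_iff)
  moreover have "filtermap \<phi> sequentially \<noteq> bot"
    by (simp add: filtermap_bot_iff)
  ultimately obtain \<psi> where \<psi>: "inf (nhds \<psi>) (filtermap \<phi> sequentially) \<noteq> bot"
    unfolding compact_filter by blast
  \<comment> \<open>\<open>G\<close> concentrates on late \<open>n\<close> with
    \<open>\<phi> n\<close> close to the cluster point \<open>\<psi>\<close>. It is proper because
    \<open>\<phi> n\<close> comes close to \<open>\<psi>\<close> for arbitrarily large
    \<open>n\<close>.\<close>
  define G where "G = inf (filtercomap \<phi> (nhds \<psi>)) sequentially"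
  have "G \<noteq> bot"
  proof
    assume "G = bot"
    then obtain P Q where PQ: "eventually P (filtercomap \<phi> (nhds \<psi>))" "eventually Q sequentially"
      "\<And>n. P n \<Longrightarrow> Q n \<Longrightarrow> False"
      unfolding G_def trivial_limit_def eventually_inf by blast
    then obtain U where U: "eventually U (nhds \<psi>)" "\<And>n. U (\<phi> n) \<Longrightarrow> P n"
      unfolding eventually_filtercomap by blast
    have "eventually (\<lambda>y. \<not> U y) (filtermap \<phi> sequentially)"
      unfolding eventually_filtermap using PQ(2) by (rule eventually_mono) (use PQ(3) U(2) in blast)
    then have "eventually (\<lambda>_. False) (inf (nhds \<psi>) (filtermap \<phi> sequentially))"
      using U(1) unfolding eventually_inf by blast
    with \<psi> show False
      by (simp add: trivial_limit_def)
  qed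
  moreover have "G \<le> sequentially"
    by (simp add: G_def)
  moreover have "((\<lambda>n. \<phi> n i) \<longlongrightarrow> \<psi> i) G" for i
  proof -
    have "filterlim \<phi> (nhds \<psi>) G"
      unfolding G_def by (rule filterlim_mono[OF filterlim_filtercomap order_refl]) simp
    then show ?thesis
      by (rule continuous_on_tendsto_compose[OF continuous_on_product_coordinates]) auto
  qed
  ultimately show ?thesis
    by (rule that)
qed

context prob_space
begin

interpretation pair: pair_prob_space M M ..

lemma fractional_coloring_finite:
  assumes "fractional_coloring M r \<mu>" "k < r"
  shows "finite_measure (\<mu> k)" "sets (\<mu> k) = sets M"
  using assms unfolding fractional_coloring_def by blast+

text \<open>\<open>X\<close> is covered by \<open>Y\<close> and \<open>X - Y\<close>, and on the
  latter the color is dominated by \<open>M\<close>. With the support and a cell union in either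
  role, this exchanges one for the other at a cost independent of the coloring.\<close>

lemma fractional_coloring_measure_le:
  assumes "fractional_coloring M r \<mu>" "k < r" "X \<in> sets (M \<Otimes>\<^sub>M M)" "Y \<in> sets (M \<Otimes>\<^sub>M M)"
  shows "measure (\<mu> k \<Otimes>\<^sub>M \<mu> k) X \<le> measure (\<mu> k \<Otimes>\<^sub>M \<mu> k) Y + measure (M \<Otimes>\<^sub>M M) (X - Y)"
proof -
  note \<mu> = fractional_coloring_finite[OF assms(1,2)]
  interpret \<mu>: finite_measure "\<mu> k \<Otimes>\<^sub>M \<mu> k"
    by (intro finite_measure_pair_measure \<mu>)
  have sets: "sets (\<mu> k \<Otimes>\<^sub>M \<mu> k) = sets (M \<Otimes>\<^sub>M M)"
    by (intro sets_pair_measure_cong \<mu>)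
  have "measure (\<mu> k \<Otimes>\<^sub>M \<mu> k) X \<le> measure (\<mu> k \<Otimes>\<^sub>M \<mu> k) (Y \<union> (X - Y))"
    using assms sets by (intro \<mu>.finite_measure_mono) auto
  also have "\<dots> \<le> measure (\<mu> k \<Otimes>\<^sub>M \<mu> k) Y + measure (\<mu> k \<Otimes>\<^sub>M \<mu> k) (X - Y)"
    using assms sets by (intro measure_Un_le) auto
  also have "measure (\<mu> k \<Otimes>\<^sub>M \<mu> k) (X - Y) \<le> measure (M \<Otimes>\<^sub>M M) (X - Y)"
    using assms \<mu> fractional_coloring_le[OF assms(1,2)] by (intro measure_pair_mono) auto
  finally show ?thesis by simp
qed

text \<open>Additivity passes to the limit, and domination by \<^term>\<open>M\<close> makes the limit countably additive.\<close>

lemma ex_limit_fractional_coloring: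
  fixes \<mu> :: "nat \<Rightarrow> nat \<Rightarrow> 'a measure"
  assumes \<mu>: "\<And>n. fractional_coloring M r (\<mu> n)"
  obtains G m where "G \<noteq> bot" "G \<le> sequentially" "fractional_coloring M r m"
    "\<And>k A. k < r \<Longrightarrow> A \<in> sets M \<Longrightarrow> ((\<lambda>n. measure (\<mu> n k) A) \<longlongrightarrow> measure (m k) A) G"
proof -
  \<comment> \<open>Padding with 0 keeps every value in the unit interval, so one application of
    compactness handles all colors and all measurable sets.\<close>
  define \<phi> where "\<phi> n z = (if fst z < r \<and> snd z \<in> sets M then measure (\<mu> n (fst z)) (snd z) else 0)"
    for n and z :: "nat \<times> 'a set"
  have "\<phi> n z \<in> {0..1}" for n z
    using fractional_coloring_le[OF \<mu>, of "fst z" "snd z" n]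
    by (auto simp: \<phi>_def intro: order_trans[OF _ prob_le_1])
  then obtain G \<psi> where G: "G \<noteq> bot" "G \<le> sequentially" and conv: "\<And>z. ((\<lambda>n. \<phi> n z) \<longlongrightarrow> \<psi> z) G"
    using ex_pointwise_convergent_subfilter[of \<phi>] by blast
  have lim: "((\<lambda>n. measure (\<mu> n k) A) \<longlongrightarrow> \<psi> (k, A)) G" if "k < r" "A \<in> sets M" for k A
    using conv[of "(k, A)"] that by (simp add: \<phi>_def)
  have nonneg: "0 \<le> \<psi> (k, A)" if "k < r" "A \<in> sets M" for k A
    using lim[OF that] by (rule tendsto_lowerbound) (simp_all add: G)
  have le: "\<psi> (k, A) \<le> prob A" if "k < r" "A \<in> sets M" for k A
    using lim[OF that] by (rule tendsto_upperbound) (simp_all add: G fractional_coloring_le[OF \<mu> that])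
  have sum: "(\<Sum>k<r. \<psi> (k, A)) = prob A" if "A \<in> sets M" for A
  proof (rule tendsto_unique[OF G(1)])
    show "((\<lambda>n. \<Sum>k<r. measure (\<mu> n k) A) \<longlongrightarrow> (\<Sum>k<r. \<psi> (k, A))) G"
      using that by (intro tendsto_sum lim) auto
    show "((\<lambda>n. \<Sum>k<r. measure (\<mu> n k) A) \<longlongrightarrow> prob A) G"
      using \<mu> that by (simp add: fractional_coloring_def)
  qed
  have add: "\<psi> (k, A \<union> B) = \<psi> (k, A) + \<psi> (k, B)"
    if "k < r" "A \<in> sets M" "B \<in> sets M" "A \<inter> B = {}" for k A B
  proof (rule tendsto_unique[OF G(1)])
    show "((\<lambda>n. measure (\<mu> n k) (A \<union> B)) \<longlongrightarrow> \<psi> (k, A \<union> B)) G"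
      using that by (intro lim) auto
    have "measure (\<mu> n k) (A \<union> B) = measure (\<mu> n k) A + measure (\<mu> n k) B" for n
      using fractional_coloring_finite[OF \<mu>[of n] that(1)] that
      by (intro finite_measure.finite_measure_Union) auto
    then show "((\<lambda>n. measure (\<mu> n k) (A \<union> B)) \<longlongrightarrow> \<psi> (k, A) + \<psi> (k, B)) G"
      using that by (simp add: tendsto_add lim)
  qed
  define m where "m k = measure_of (space M) (sets M) (\<lambda>A. ennreal (\<psi> (k, A)))" for k
  have emeasure_m: "emeasure (m k) A = ennreal (\<psi> (k, A))" if k: "k < r" and A: "A \<in> sets M" for k A
    unfolding m_def
  proof (rule emeasure_measure_of_sigma[OF sets.sigma_algebra_axioms _ _ A])
    have empty: "\<psi> (k, {}) = 0"
      using nonneg[OF k, of "{}"] le[OF k, of "{}"] by simp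
    then show pos: "positive (sets M) (\<lambda>A. ennreal (\<psi> (k, A)))"
      by (simp add: positive_def)
    show "countably_additive (sets M) (\<lambda>A. ennreal (\<psi> (k, A)))"
    proof (rule sets.empty_continuous_imp_countably_additive[OF pos])
      show "additive (sets M) (\<lambda>A. ennreal (\<psi> (k, A)))"
        using add[OF k] nonneg[OF k] by (auto simp: additive_def ennreal_plus)
      show "\<forall>A\<in>sets M. ennreal (\<psi> (k, A)) \<noteq> \<infinity>"
        by simp
      fix A :: "nat \<Rightarrow> 'a set" assume A: "range A \<subseteq> sets M" "decseq A" "(\<Inter>i. A i) = {}"
      have "(\<lambda>i. prob (A i)) \<longlonglongrightarrow> 0"
        using finite_Lim_measure_decseq[OF A(1,2)] A(3) by simp
      then have "(\<lambda>i. \<psi> (k, A i)) \<longlonglongrightarrow> 0"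
      proof (rule tendsto_sandwich[OF _ _ tendsto_const, rotated 2])
        have "A i \<in> sets M" for i
          using A(1) by blast
        then show "\<forall>\<^sub>F i in sequentially. 0 \<le> \<psi> (k, A i)"
            "\<forall>\<^sub>F i in sequentially. \<psi> (k, A i) \<le> prob (A i)"
          by (simp_all add: nonneg[OF k] le[OF k])
      qed
      from tendsto_ennrealI[OF this] show "(\<lambda>i. ennreal (\<psi> (k, A i))) \<longlonglongrightarrow> 0"
        by simp
    qed
  qed
  have sets_m: "sets (m k) = sets M" and space_m: "space (m k) = space M" for k
    by (simp_all add: m_def)
  have measure_m: "measure (m k) A = \<psi> (k, A)" if "k < r" "A \<in> sets M" for k A
    using emeasure_m[OF that] nonneg[OF that] by (simp add: measure_def)
  show ?thesis
  proof (rule that[OF G])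
    show "fractional_coloring M r m"
      unfolding fractional_coloring_def
    proof (intro conjI allI impI ballI sets_m)
      show "finite_measure (m k)" if "k < r" for k
        using emeasure_m[OF that sets.top] by (intro finite_measureI) (simp add: space_m)
      show "(\<Sum>k<r. measure (m k) A) = prob A" if "A \<in> sets M" for A
        using that sum by (simp add: measure_m)
    qed
    show "((\<lambda>n. measure (\<mu> n k) A) \<longlongrightarrow> measure (m k) A) G" if "k < r" "A \<in> sets M" for k A
      using lim[OF that] measure_m[OF that] by simp
  qed
qed

end

context graphon_space
begin

interpretation pair: pair_prob_space M M ..

text \<open>Each third of \<open>e\<close> pays for one error: the part of the support missed by the
  cell union, the excess of the cell union over the support, and the diagonal term
  \<open>1 / L\<close>.\<close>

lemma ex_fractional_coloring_support_le:
  assumes sp: "subgraph_perfect M W" "\<And>s. 0 < hom_density s (complete_edges s) M W \<Longrightarrow> s \<le> r"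
    and e: "e > 0"
  shows "\<exists>\<mu>. fractional_coloring M r \<mu> \<and> (\<forall>k<r. measure (\<mu> k \<Otimes>\<^sub>M \<mu> k) support \<le> e)"
proof -
  obtain p R where p: "finite_partition_map M p"
    and pR: "measure (M \<Otimes>\<^sub>M M) (sym_diff support (cell_union (space M) p R)) < e / 3"
    using cell_approximable[OF sets_support] e unfolding cell_approximable_def
    by (meson divide_pos_pos zero_less_numeral)
  let ?T = "cell_union (space M) p R"
  note T = sets_cell_union[OF p, of R]
  obtain n where n: "inverse (real (Suc n)) < e / 3"
    using e reals_Archimedean[of "e / 3"] by auto
  define L where "L = Suc n"
  have L: "L > 0" "1 / real L < e / 3"
    using n by (simp_all add: L_def inverse_eq_divide del: of_nat_Suc)
  from ex_fractional_coloring_cell_union[OF sp p L(1), of R]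
  obtain \<mu> where "fractional_coloring M r \<mu> \<and>
    (\<forall>k<r. measure (\<mu> k \<Otimes>\<^sub>M \<mu> k) ?T \<le> measure (M \<Otimes>\<^sub>M M) (?T - support) + 1 / L)" ..
  then have \<mu>: "fractional_coloring M r \<mu>"
    "\<And>k. k < r \<Longrightarrow> measure (\<mu> k \<Otimes>\<^sub>M \<mu> k) ?T \<le> measure (M \<Otimes>\<^sub>M M) (?T - support) + 1 / L"
    by simp_all
  have "measure (\<mu> k \<Otimes>\<^sub>M \<mu> k) support \<le> e" if k: "k < r" for k
  proof -
    have "measure (M \<Otimes>\<^sub>M M) (?T - support) < e / 3" "measure (M \<Otimes>\<^sub>M M) (support - ?T) < e / 3"
      by (rule le_less_trans[OF pair.P.finite_measure_mono pR]; use T in auto)+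
    then show ?thesis
      using fractional_coloring_measure_le[OF \<mu>(1) k sets_support T] \<mu>(2)[OF k] L(2) by linarith
  qed
  with \<mu>(1) show ?thesis by blast
qed

text \<open>Setwise convergence of the colors gives convergence of their product measures directly
  only on finite unions of rectangles. The support is therefore exchanged for a cell union before
  the limit and back after it, each time at a cost below \<open>e / 2\<close>; the cell union
  depends on \<open>e\<close> but not on \<open>n\<close>.\<close>

lemma ex_fractional_coloring_support_eq_0:
  assumes sp: "subgraph_perfect M W" "\<And>s. 0 < hom_density s (complete_edges s) M W \<Longrightarrow> s \<le> r"
  shows "\<exists>\<mu>. fractional_coloring M r \<mu> \<and> (\<forall>k<r. measure (\<mu> k \<Otimes>\<^sub>M \<mu> k) support = 0)"
proof -
  have "\<forall>n. \<exists>\<mu>. fractional_coloring M r \<mu> \<and> (\<forall>k<r. measure (\<mu> k \<Otimes>\<^sub>M \<mu> k) support \<le> inverse (real (Suc n)))"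
    by (intro allI ex_fractional_coloring_support_le sp) simp_all
  from choice[OF this] obtain \<mu> where "\<forall>n. fractional_coloring M r (\<mu> n) \<and>
      (\<forall>k<r. measure (\<mu> n k \<Otimes>\<^sub>M \<mu> n k) support \<le> inverse (real (Suc n)))" ..
  then have \<mu>: "fractional_coloring M r (\<mu> n)"
    and \<mu>_support: "k < r \<Longrightarrow> measure (\<mu> n k \<Otimes>\<^sub>M \<mu> n k) support \<le> inverse (real (Suc n))" for n k
    by simp_all
  obtain G m where G: "G \<noteq> bot" "G \<le> sequentially" and m: "fractional_coloring M r m"
    and lim: "\<And>k A. k < r \<Longrightarrow> A \<in> sets M \<Longrightarrow> ((\<lambda>n. measure (\<mu> n k) A) \<longlongrightarrow> measure (m k) A) G"
    by (rule ex_limit_fractional_coloring[where \<mu> = \<mu>, OF \<mu>]) (rule that)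
  have le: "measure (m k \<Otimes>\<^sub>M m k) support \<le> 0 + e" if k: "k < r" and e: "e > 0" for k e
  proof -
    obtain p R where p: "finite_partition_map M p"
      and pR: "measure (M \<Otimes>\<^sub>M M) (sym_diff support (cell_union (space M) p R)) < e / 2"
      using cell_approximable[OF sets_support] e unfolding cell_approximable_def
      by (meson half_gt_zero)
    let ?T = "cell_union (space M) p R"
    note T = sets_cell_union[OF p, of R]
    have diff: "measure (M \<Otimes>\<^sub>M M) (?T - support) < e / 2" "measure (M \<Otimes>\<^sub>M M) (support - ?T) < e / 2"
      by (rule le_less_trans[OF pair.P.finite_measure_mono pR]; use T in auto)+
    have "((\<lambda>n. measure (\<mu> n k \<Otimes>\<^sub>M \<mu> n k) ?T) \<longlongrightarrow> measure (m k \<Otimes>\<^sub>M m k) ?T) G"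
      unfolding measure_cell_union[OF fractional_coloring_finite(1,2)[OF \<mu> k] p]
        measure_cell_union[OF fractional_coloring_finite(1,2)[OF m k] p] case_prod_beta'
      by (intro tendsto_sum tendsto_mult lim k sets_cell p)
    moreover have "((\<lambda>n. inverse (real (Suc n)) + e / 2) \<longlongrightarrow> 0 + e / 2) G"
      by (intro tendsto_add tendsto_const tendsto_mono[OF G(2) LIMSEQ_inverse_real_of_nat])
    moreover have "\<forall>\<^sub>F n in G. measure (\<mu> n k \<Otimes>\<^sub>M \<mu> n k) ?T \<le> inverse (real (Suc n)) + e / 2"
    proof (intro always_eventually allI)
      fix n
      show "measure (\<mu> n k \<Otimes>\<^sub>M \<mu> n k) ?T \<le> inverse (real (Suc n)) + e / 2"
        using fractional_coloring_measure_le[OF \<mu> k T sets_support, of n] \<mu>_support[OF k, of n] diff(1)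
        by linarith
    qed
    ultimately have "measure (m k \<Otimes>\<^sub>M m k) ?T \<le> 0 + e / 2"
      using G(1) by (intro tendsto_le) auto
    then show ?thesis
      using fractional_coloring_measure_le[OF m k sets_support T] diff(2) by linarith
  qed
  have "measure (m k \<Otimes>\<^sub>M m k) support \<le> 0" if "k < r" for k
    by (rule field_le_epsilon) (rule le[OF that])
  then have "\<forall>k<r. measure (m k \<Otimes>\<^sub>M m k) support = 0"
    using measure_nonneg antisym by blast
  with m show ?thesis by blast
qed

section \<open>From a fractional coloring to a proper coloring\<close>

lemma ex_proper_coloring_if_fractional_coloring:
  assumes m: "fractional_coloring M r m" and m0: "\<And>k. k < r \<Longrightarrow> measure (m k \<Otimes>\<^sub>M m k) support = 0"
  shows "\<exists>f. proper_coloring M W r f"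
proof -
  note fin = fractional_coloring_finite[OF m]
  have "\<exists>g\<in>borel_measurable M. density M g = m k" if k: "k < r" for k
  proof (rule Radon_Nikodym)
    show "absolutely_continuous M (m k)"
      unfolding absolutely_continuous_def
    proof
      fix A assume A: "A \<in> null_sets M"
      then have "measure (m k) A \<le> 0"
        using fractional_coloring_le[OF m k, of A] by (auto simp: measure_def null_sets_def)
      then have "measure (m k) A = 0"
        using measure_nonneg by (rule antisym)
      then have "emeasure (m k) A = 0"
        by (simp add: finite_measure.emeasure_eq_measure[OF fin(1)[OF k]])
      then show "A \<in> null_sets (m k)"
        using A fin(2)[OF k] by (auto simp: null_sets_def)
    qed
  qed (rule fin(2)[OF k])
  then obtain g where g: "\<And>k. k < r \<Longrightarrow> g k \<in> borel_measurable M" "\<And>k. k < r \<Longrightarrow> density M (g k) = m k"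
    by metis
  have indep: "AE z in M \<Otimes>\<^sub>M M. g k (fst z) \<noteq> 0 \<and> g k (snd z) \<noteq> 0 \<longrightarrow> z \<notin> support" if k: "k < r" for k
  proof -
    note [measurable] = g(1)[OF k]
    have "m k \<Otimes>\<^sub>M m k = density (M \<Otimes>\<^sub>M M) (\<lambda>(x, y). g k x * g k y)"
      unfolding g(2)[OF k, symmetric]
      by (intro pair_measure_density g(1) k sigma_finite_measure_axioms)
        (simp add: g(2)[OF k] finite_measure.axioms(1) fin(1)[OF k])
    moreover have "emeasure (m k \<Otimes>\<^sub>M m k) support = 0"
      using m0[OF k] finite_measure.emeasure_eq_measure[OF finite_measure_pair_measure[OF fin(1)[OF k] fin(1)[OF k]]]
      by simp
    ultimately have "(\<integral>\<^sup>+z. g k (fst z) * g k (snd z) * indicator support z \<partial>(M \<Otimes>\<^sub>M M)) = 0"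
      by (simp add: emeasure_density case_prod_beta')
    then have "AE z in M \<Otimes>\<^sub>M M. g k (fst z) * g k (snd z) * indicator support z = 0"
      by (subst (asm) nn_integral_0_iff_AE) auto
    then show ?thesis
      by (rule AE_mp) (auto simp: indicator_def intro!: AE_I2)
  qed
  \<comment> \<open>\<open>Z\<close> consists of the points missed by all densities. Every
    \<open>m k\<close> vanishes on it and these masses add up to that of \<open>M\<close>, so
    \<open>Z\<close> is null.\<close>
  define Z where "Z = {x \<in> space M. \<forall>k\<in>{..<r}. g k x = 0}"
  have Z: "Z \<in> sets M"
    unfolding Z_def using g(1) by (intro sets.sets_Collect_finite_All) (auto intro!: borel_measurable_eq)
  have "measure (m k) Z = 0" if k: "k < r" for k
  proof -
    have "emeasure (m k) Z = (\<integral>\<^sup>+x. g k x * indicator Z x \<partial>M)"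
      unfolding g(2)[OF k, symmetric] by (intro emeasure_density g(1) k Z)
    also have "\<dots> = (\<integral>\<^sup>+x. 0 \<partial>M)"
      using k by (intro nn_integral_cong) (auto simp: Z_def indicator_def)
    finally show ?thesis by (simp add: measure_def)
  qed
  moreover have "prob Z = (\<Sum>k<r. measure (m k) Z)"
    using m Z by (simp add: fractional_coloring_def)
  ultimately have "prob Z = 0"
    by simp
  then have Z_null: "emeasure M Z = 0"
    by (simp add: emeasure_eq_measure)
  have "AE z in M \<Otimes>\<^sub>M M. z \<notin> Z \<times> space M \<union> space M \<times> Z"
    using Z Z_null by (intro AE_not_in null_sets.Un) (auto simp: null_sets_def emeasure_pair_measure_Times)
  then have AE_Z: "AE z in M \<Otimes>\<^sub>M M. fst z \<notin> Z \<and> snd z \<notin> Z"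
    by (rule AE_mp) (auto simp: space_pair_measure intro!: AE_I2)
  \<comment> \<open>Color 0 must exist, as it is the default on \<open>Z\<close>.\<close>
  have "r \<noteq> 0"
  proof
    assume "r = 0"
    then have "prob (space M) = 0"
      using m by (simp add: fractional_coloring_def)
    then show False
      by (simp add: prob_space)
  qed
  \<comment> \<open>The sets of positive density may overlap, so the least available color is taken.
    The value 0 on \<open>Z\<close> is arbitrary: almost no pair meets \<open>Z\<close>, and the
    class of color 0 stays independent.\<close>
  define f where "f x = (if x \<in> Z then 0 else LEAST k. k < r \<and> g k x \<noteq> 0)" for x
  have f: "f x < r" "x \<notin> Z \<Longrightarrow> g (f x) x \<noteq> 0" if "x \<in> space M" for x
  proof -
    have "f x < r \<and> (x \<notin> Z \<longrightarrow> g (f x) x \<noteq> 0)"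
    proof (cases "x \<in> Z")
      case False
      then have "\<exists>k. k < r \<and> g k x \<noteq> 0"
        using that by (auto simp: Z_def)
      from LeastI_ex[OF this] False show ?thesis
        by (simp add: f_def)
    qed (use \<open>r \<noteq> 0\<close> in \<open>simp add: f_def\<close>)
    then show "f x < r" "x \<notin> Z \<Longrightarrow> g (f x) x \<noteq> 0" by auto
  qed
  have pred: "Measurable.pred M (\<lambda>x. k < r \<and> g k x \<noteq> 0)" for k
    using g(1)[of k] by (cases "k < r") auto
  have f_meas: "f \<in> M \<rightarrow>\<^sub>M count_space UNIV"
    unfolding f_def using Z by (intro measurable_If measurable_Least pred) simp_all
  have "independent_in M W (f -` {k} \<inter> space M)" if k: "k < r" for k
    unfolding independent_in_def
  proof
    show "f -` {k} \<inter> space M \<in> sets M"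
      using f_meas by (rule measurable_sets) simp
    show "AE (x, y) in M \<Otimes>\<^sub>M M. (x, y) \<in> (f -` {k} \<inter> space M) \<times> (f -` {k} \<inter> space M) \<longrightarrow> W x y = 0"
      using indep[OF k] AE_Z unfolding case_prod_beta'
    proof eventually_elim
      case (elim z)
      show ?case
      proof
        assume "(fst z, snd z) \<in> (f -` {k} \<inter> space M) \<times> (f -` {k} \<inter> space M)"
        then have z: "fst z \<in> space M" "f (fst z) = k" "snd z \<in> space M" "f (snd z) = k"
          by auto
        then have "z \<notin> support"
          using elim f(2)[of "fst z"] f(2)[of "snd z"] by simp
        then show "W (fst z) (snd z) = 0"
          using z by (simp add: support_def space_pair_measure mem_Times_iff)
      qed
    qed
  qed
  moreover have "f \<in> M \<rightarrow>\<^sub>M count_space {..<r}"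
    unfolding measurable_count_space_eq2[OF finite_lessThan]
    using f(1) measurable_sets[OF f_meas, of "{k}" for k] by simp
  ultimately show ?thesis
    unfolding proper_coloring_def by blast
qed

theorem chromatic_number_eq_clique_number:
  assumes "subgraph_perfect M W"
  shows "chromatic_number M W = clique_number M W"
proof (rule antisym[OF _ clique_number_le_chromatic_number])
  show "chromatic_number M W \<le> clique_number M W"
  \<comment> \<open>An infinite clique number bounds everything; only a finite value
    \<open>r\<close> calls for a coloring.\<close>
  proof (cases "clique_number M W")
    case (enat r)
    have "s \<le> r" if "0 < hom_density s (complete_edges s) M W" for s
    proof -
      have "enat s \<le> clique_number M W"
        unfolding clique_number_def using that by (intro Sup_upper) blast
      then show ?thesis by (simp add: enat)
    qed
    from ex_fractional_coloring_support_eq_0[OF assms this]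
    obtain m where "fractional_coloring M r m \<and> (\<forall>k<r. measure (m k \<Otimes>\<^sub>M m k) support = 0)" ..
    then have "\<exists>f. proper_coloring M W r f"
      by (intro ex_proper_coloring_if_fractional_coloring[of r m]) simp_all
    then obtain f where "proper_coloring M W r f" ..
    then show ?thesis
      unfolding chromatic_number_def enat by (intro Inf_lower) blast
  qed simp
qed

end

theorem theorem7p6:
  fixes M :: "'a measure" and W :: "'a \<Rightarrow> 'a \<Rightarrow> real"
  assumes "prob_space M" and "standard_borel M" and "atomless M"
    and "graphon M W"
    and "properly_subgraph_perfect M W"
  shows "inheritance_perfect M W"
  unfolding inheritance_perfect_def
proof (intro ballI impI)
  fix A assume A: "A \<in> sets M" "0 < emeasure M A"
  interpret graphon_space "restrict_prob M A" W
    using assms(1,4) A by (intro graphon_space.intro graphon_space_axioms.intro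
        prob_space_restrict_prob graphon_restrict_prob) simp_all
  have "subgraph_perfect (restrict_prob M A) W"
    using assms A by (intro subgraph_perfect_restrict_prob) (simp_all add: properly_subgraph_perfect_def)
  then show "chromatic_number (restrict_prob M A) W = clique_number (restrict_prob M A) W"
    by (rule chromatic_number_eq_clique_number)
qed

end
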